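(* Let $n\geq 2$ and $\gamma \geq 0$. For $\lambda >0$, let $R_\lambda^{\mathcal{D}}$ denote any cuboid which maximises $\operatorname{Tr}(-\Delta_R^{\mathcal{D}}-\lambda)_-^\gamma$ among all $n$-dimensional cuboids $R$ of unit measure, and let $a_{1,\lambda}^*\le\dots\le a_{n,\lambda}^*$ be its side-lengths. Then, for any admissible exponent $\theta_n$ (as defined in the context), as $\lambda \to \infty$, $$a_{n,\lambda}^* = 1+O\bigl(\lambda^{(\theta_n-(n-1))/4}\bigr).$$
   Context: An $n$-dimensional cuboid of unit measure is a domain $R=\prod_{i=1}^n (0,a_i)\subset\mathbb{R}^n$ with $a_i>0$, $\prod_{i=1}^n a_i=1$, with side-lengths labelled so that $a_1\le\dots\le a_n$. $\lambda_1(R)\le\lambda_2(R)\le\dots$ are the eigenvalues of the Dirichlet Laplacian $-\Delta_R^{\mathcal{D}}$ on $R$, repeated according to multiplicity: the numbers $\sum_{j=1}^n \pi^2 i_j^2/a_j^2$ with $i_j$ positive integers. The Riesz mean of order $\gamma\ge0$ is $$\operatorname{Tr}(-\Delta_R^{\mathcal{D}}-\lambda)_-^\gamma=\sum_{k:\lambda_k(R)\le\lambda}(\lambda-\lambda_k(R))^\gamma,$$ with the convention $0^0=1$, so that for $\gamma=0$ it is the counting function $\#\{k:\lambda_k(R)\le\lambda\}$. A maximising cuboid exists (it need not be unique). Admissible exponent: $\theta_n$ denotes any exponent such that for all $a_1,\dots,a_n>0$, $$\#\{z\in\mathbb{Z}^n: a_1^{-2}z_1^2+\dots+a_n^{-2}z_n^2\le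 t^2\}-\omega_n t^n\prod_{i=1}^n a_i = O(t^{\theta_n}),\quad t\to\infty,$$ uniformly for $a_1,\dots,a_n$ in compact subsets of $(0,\infty)$, where $\omega_n$ is the volume of the unit ball in $\mathbb{R}^n$. It is known that for every $n\ge2$ there are admissible exponents with $\theta_n<n-1$. *)

theory Defs
  imports "HOL-Analysis.Analysis" "HOL-Library.Landau_Symbols"
begin

text \<open>
  The cuboid \<open>(0,a 1) \<times> \<dots> \<times> (0,a n)\<close> is represented by the tuple \<open>a\<close> of its side-lengths, labelled
  by \<open>{1..n}\<close> in nondecreasing order; values of \<open>a\<close> outside \<open>{1..n}\<close> play no role.
\<close>

definition unit_cuboid :: "nat \<Rightarrow> (nat \<Rightarrow> real) \<Rightarrow> bool" where
  "unit_cuboid n a \<longleftrightarrow>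
     (\<forall>i\<in>{1..n}. 0 < a i) \<and> mono_on {1..n} a \<and> (\<Prod>i=1..n. a i) = 1"

text \<open>
  The Dirichlet eigenvalues of the cuboid are indexed by tuples \<open>k\<close> of \<open>n\<close> positive integers.
  Summing over these tuples, and not over the set of eigenvalues, counts multiplicities.
\<close>

definition dirichlet_indices :: "nat \<Rightarrow> (nat \<Rightarrow> nat) set" where
  "dirichlet_indices n = {1..n} \<rightarrow>\<^sub>E {1..}"

definition dirichlet_eigenvalue :: "nat \<Rightarrow> (nat \<Rightarrow> real) \<Rightarrow> (nat \<Rightarrow> nat) \<Rightarrow> real" where
  "dirichlet_eigenvalue n a k = (\<Sum>j=1..n. pi\<^sup>2 * (real (k j))\<^sup>2 / (a j)\<^sup>2)"

text \<open>
  The case distinction implements the convention \<open>0\<^sup>0 = 1\<close>, because \<open>0 powr 0 = 0\<close> in the library.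
\<close>

definition riesz_mean :: "nat \<Rightarrow> real \<Rightarrow> real \<Rightarrow> (nat \<Rightarrow> real) \<Rightarrow> real" where
  "riesz_mean n \<gamma> \<mu> a =
     (\<Sum>k \<in> {k \<in> dirichlet_indices n. dirichlet_eigenvalue n a k \<le> \<mu>}.
        if \<gamma> = 0 then 1 else (\<mu> - dirichlet_eigenvalue n a k) powr \<gamma>)"

definition maximising_cuboid :: "nat \<Rightarrow> real \<Rightarrow> real \<Rightarrow> (nat \<Rightarrow> real) \<Rightarrow> bool" where
  "maximising_cuboid n \<gamma> \<mu> a \<longleftrightarrow> is_arg_max (riesz_mean n \<gamma> \<mu>) (unit_cuboid n) a"

definition ellipsoid_count :: "nat \<Rightarrow> (nat \<Rightarrow> real) \<Rightarrow> real \<Rightarrow> nat" where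
  "ellipsoid_count n a t =
     card {z \<in> {1..n} \<rightarrow>\<^sub>E (UNIV :: int set). (\<Sum>i=1..n. (real_of_int (z i))\<^sup>2 / (a i)\<^sup>2) \<le> t\<^sup>2}"

text \<open>The constants \<open>C\<close> and \<open>T\<close> may depend on the compact set \<open>K\<close>, but not on \<open>a\<close>.\<close>

definition admissible_exponent :: "nat \<Rightarrow> real \<Rightarrow> bool" where
  "admissible_exponent n \<theta> \<longleftrightarrow>
     (\<forall>K. compact K \<and> K \<subseteq> {0<..} \<longrightarrow>
        (\<exists>C T. \<forall>a. (\<forall>i\<in>{1..n}. a i \<in> K) \<longrightarrow>
           (\<forall>t\<ge>T. \<bar>real (ellipsoid_count n a t) - unit_ball_vol (real n) * t ^ n * (\<Prod>i=1..n. a i)\<bar>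
                     \<le> C * t powr \<theta>)))"

text \<open>
  The sum and the cardinality above range over finite sets, so they never take their
  default value \<open>0\<close> for infinite sets.
\<close>

lemma finite_ellipsoid:
  fixes a :: "nat \<Rightarrow> real"
  assumes "\<And>i. i \<in> {1..n} \<Longrightarrow> 0 < a i"
  shows "finite {z \<in> {1..n} \<rightarrow>\<^sub>E (UNIV :: int set). (\<Sum>i=1..n. (real_of_int (z i))\<^sup>2 / (a i)\<^sup>2) \<le> s}"
proof -
  define B where "B i = \<lceil>s * (a i)\<^sup>2\<rceil>" for i
  have "z i \<in> {- B i..B i}"
    if s: "(\<Sum>i=1..n. (real_of_int (z i))\<^sup>2 / (a i)\<^sup>2) \<le> s" and i: "i \<in> {1..n}" for z :: "nat \<Rightarrow> int" and i
  proof -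
    have "(real_of_int (z i))\<^sup>2 / (a i)\<^sup>2 \<le> (\<Sum>i=1..n. (real_of_int (z i))\<^sup>2 / (a i)\<^sup>2)"
      by (rule member_le_sum[OF i]) auto
    then have "(real_of_int (z i))\<^sup>2 / (a i)\<^sup>2 \<le> s"
      using s by linarith
    then have "(real_of_int (z i))\<^sup>2 \<le> s * (a i)\<^sup>2"
      using assms[OF i] by (simp add: field_simps)
    then have "real_of_int ((z i)\<^sup>2) \<le> s * (a i)\<^sup>2" by simp
    then have "(z i)\<^sup>2 \<le> B i"
      unfolding B_def by (meson le_of_int_ceiling of_int_le_iff order_trans)
    moreover have "\<bar>z i\<bar> \<le> (z i)\<^sup>2"
      using self_le_power[of "\<bar>z i\<bar>" 2] by (cases "z i = 0") auto
    ultimately show ?thesis by auto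
  qed
  then have "{z \<in> {1..n} \<rightarrow>\<^sub>E (UNIV :: int set). (\<Sum>i=1..n. (real_of_int (z i))\<^sup>2 / (a i)\<^sup>2) \<le> s}
      \<subseteq> (\<Pi>\<^sub>E i\<in>{1..n}. {- B i..B i})"
    by (auto simp: PiE_iff extensional_def)
  then show ?thesis
    by (rule finite_subset) (auto intro!: finite_PiE)
qed

lemma finite_dirichlet_indices_le:
  assumes "unit_cuboid n a"
  shows "finite {k \<in> dirichlet_indices n. dirichlet_eigenvalue n a k \<le> \<mu>}"
proof -
  define B where "B i = nat \<lceil>\<mu> * (a i)\<^sup>2\<rceil>" for i
  have "k i \<le> B i" if k: "dirichlet_eigenvalue n a k \<le> \<mu>" and i: "i \<in> {1..n}" for k i
  proof -
    have a: "0 < a i" using assms i by (auto simp: unit_cuboid_def)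
    have "pi\<^sup>2 * (real (k i))\<^sup>2 / (a i)\<^sup>2 \<le> dirichlet_eigenvalue n a k"
      unfolding dirichlet_eigenvalue_def by (rule member_le_sum[OF i]) auto
    then have "pi\<^sup>2 * (real (k i))\<^sup>2 / (a i)\<^sup>2 \<le> \<mu>"
      using k by linarith
    then have "pi\<^sup>2 * (real (k i))\<^sup>2 \<le> \<mu> * (a i)\<^sup>2"
      using a by (simp add: field_simps)
    moreover have "1 \<le> pi\<^sup>2" using pi_gt3 by (simp add: power2_eq_square mult_ge1_I)
    then have "1 * (real (k i))\<^sup>2 \<le> pi\<^sup>2 * (real (k i))\<^sup>2" by (intro mult_right_mono) auto
    moreover have "real (k i) \<le> (real (k i))\<^sup>2"
      by (cases "k i") (auto simp: power2_eq_square)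
    ultimately have "real (k i) \<le> \<mu> * (a i)\<^sup>2" by linarith
    then show ?thesis unfolding B_def by linarith
  qed
  then have "{k \<in> dirichlet_indices n. dirichlet_eigenvalue n a k \<le> \<mu>} \<subseteq> (\<Pi>\<^sub>E i\<in>{1..n}. {..B i})"
    by (auto simp: dirichlet_indices_def PiE_iff extensional_def)
  then show ?thesis
    by (rule finite_subset) (auto intro!: finite_PiE)
qed

end

theory Submission
  imports Defs "HOL-Real_Asymp.Real_Asymp"
begin

text \<open>
  Only the comparison of a maximiser with the unit cube matters. Up to the factor \<open>\<pi>\<^sup>2\<close>, the
  eigenvalues count lattice points with positive coordinates in an ellipsoid, and their volume term
  is the same for all unit cuboids. A slicing induction on the dimension shows that a short side
  \<open>a 1\<close> costs at least a multiple of \<open>t\<^bsup>n-1\<^esup> / a 1\<close> points, whereas the cube loses only \<open>O(t\<^bsup>n-1\<^esup>)\<close>;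
  hence the sides of maximisers stay in a compact set. On a compact set the points of the full
  ellipsoid, sorted by their vanishing coordinates, give the two-term asymptotics of the positive
  count with error \<open>O(t\<^bsup>\<theta>\<^esup>)\<close>, since \<open>\<theta> \<ge> n - 2\<close>. So \<open>(\<Sum>i. 1 / a i) - n\<close>, which is of order
  at least \<open>(a n - 1)\<^sup>2\<close>, is \<open>O(t\<^bsup>\<theta>-(n-1)\<^esup>)\<close>, with \<open>t\<close> of order \<open>\<mu>\<^bsup>1/2\<^esup>\<close>. Riesz means are reduced to
  counts by the layer-cake formula.
\<close>

subsection \<open>Riemann sums of slice volumes\<close>

text \<open>
  The slice of the unit ball at height \<open>u\<close> is a ball of radius \<open>sqrt (1 - u\<^sup>2)\<close>; the case distinction
  is needed for \<open>m = 0\<close> as well, where the power does not vanish beyond \<open>u = 1\<close>. The number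
  \<open>orthant_volume m\<close> is the volume of the part of the unit ball in the positive orthant.
\<close>

definition slice_profile :: "nat \<Rightarrow> real \<Rightarrow> real" where
  "slice_profile m u = (if u \<le> 1 then sqrt (1 - u\<^sup>2) ^ m else 0)"

definition slice_volume :: "nat \<Rightarrow> real" where
  "slice_volume m = integral {0..1} (slice_profile m)"

primrec orthant_volume :: "nat \<Rightarrow> real" where
  "orthant_volume 0 = 1"
| "orthant_volume (Suc m) = orthant_volume m * slice_volume m"

lemma slice_profile_nonneg: "0 \<le> u \<Longrightarrow> 0 \<le> slice_profile m u"
  by (simp add: slice_profile_def power_le_one)

lemma slice_profile_0: "slice_profile m 0 = 1"
  by (simp add: slice_profile_def)

lemma slice_profile_antimono: "0 \<le> u \<Longrightarrow> u \<le> v \<Longrightarrow> slice_profile m v \<le> slice_profile m u"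
  by (auto simp: slice_profile_def power_le_one intro!: power_mono)

lemma antimono_integrable_on:
  fixes f :: "real \<Rightarrow> real"
  assumes "\<And>x y. a \<le> x \<Longrightarrow> x \<le> y \<Longrightarrow> f y \<le> f x"
  shows "f integrable_on {a..b}"
proof -
  have "(\<lambda>x. - f x) integrable_on {a..b}"
    by (rule integrable_on_mono_on) (auto simp: mono_on_def assms)
  then show ?thesis by (simp only: integrable_neg_iff)
qed

text \<open>
  On each cell the integral of \<open>f\<close> exceeds the lower Riemann sum by at least the drop of \<open>f\<close> from the
  middle of the cell to three quarters of it, times half the mesh.
\<close>

lemma refined_lower_sum:
  fixes f :: "real \<Rightarrow> real"
  assumes mono: "\<And>x y. 0 \<le> x \<Longrightarrow> x \<le> y \<Longrightarrow> f y \<le> f x" and h: "0 < h"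
  shows "(\<Sum>k=1..N. h * f (real k * h) + h / 2 * (f ((real k - 1/2) * h) - f ((real k - 1/4) * h)))
           \<le> integral {0..real N * h} f"
proof (induction N)
  case (Suc N)
  have int: "f integrable_on {x..y}" if "0 \<le> x" for x y
    by (rule antimono_integrable_on) (use mono that in auto)
  \<comment> \<open>The cell is cut at its midpoint \<open>q\<close>: \<open>f q\<close> bounds
    \<open>f\<close> from below on the left half, \<open>f r\<close> on the right half. In the drop,
    \<open>f r\<close> is then weakened to the value at three quarters of the cell, a point that
    stays inside [0,1] for coarser meshes when the lemma is applied to slices.\<close>
  define p q r where "p = real N * h" and "q = p + h / 2" and "r = p + h"
  have pqr: "0 \<le> p" "p \<le> q" "q \<le> r" and rS: "r = real (Suc N) * h"
    using h by (auto simp: p_def q_def r_def algebra_simps)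
  have "integral {p..q} (\<lambda>_. f q) \<le> integral {p..q} f"
    by (rule integral_le) (use int pqr mono in auto)
  moreover have "integral {q..r} (\<lambda>_. f r) \<le> integral {q..r} f"
    by (rule integral_le) (use int pqr mono in auto)
  moreover have "integral {0..p} f + integral {p..r} f = integral {0..r} f"
    by (rule Henstock_Kurzweil_Integration.integral_combine) (use int pqr in auto)
  moreover have "integral {p..q} f + integral {q..r} f = integral {p..r} f"
    by (rule Henstock_Kurzweil_Integration.integral_combine) (use int pqr in auto)
  moreover have "integral {p..q} (\<lambda>_. f q) = h / 2 * f q" "integral {q..r} (\<lambda>_. f r) = h / 2 * f r"
    using h by (auto simp: q_def r_def)
  ultimately have *: "integral {0..p} f + h / 2 * f q + h / 2 * f r \<le> integral {0..r} f"
    by linarith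
  have "(real (Suc N) - 1/2) * h = q" "(real (Suc N) - 1/4) * h = r - h / 4"
    by (auto simp: p_def q_def r_def field_simps)
  moreover have "h / 2 * f r \<le> h / 2 * f (r - h / 4)"
    using h pqr by (intro mult_left_mono mono) (auto simp: r_def)
  moreover have "h * f r = h / 2 * f r + h / 2 * f r"
    by (simp add: field_simps)
  ultimately have "h * f (real (Suc N) * h)
        + h / 2 * (f ((real (Suc N) - 1/2) * h) - f ((real (Suc N) - 1/4) * h))
      \<le> integral {0..r} f - integral {0..p} f"
    using * unfolding rS[symmetric] right_diff_distrib by (simp only:)
  then show ?case
    using Suc.IH unfolding rS p_def by (simp only: sum.cl_ivl_Suc One_nat_def Suc_less_eq not_less_zero if_False)
qed simp

lemma lower_sum:
  fixes f :: "real \<Rightarrow> real"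
  assumes mono: "\<And>x y. 0 \<le> x \<Longrightarrow> x \<le> y \<Longrightarrow> f y \<le> f x" and h: "0 < h"
  shows "h * (\<Sum>k=1..N. f (real k * h)) \<le> integral {0..real N * h} f"
proof -
  have "h * (\<Sum>k=1..N. f (real k * h))
      \<le> (\<Sum>k=1..N. h * f (real k * h) + h / 2 * (f ((real k - 1/2) * h) - f ((real k - 1/4) * h)))"
    unfolding sum_distrib_left using h by (intro sum_mono) (auto intro!: mono mult_nonneg_nonneg mult_right_mono)
  also have "\<dots> \<le> integral {0..real N * h} f"
    by (rule refined_lower_sum) (use assms in auto)
  finally show ?thesis .
qed

lemma upper_sum:
  fixes f :: "real \<Rightarrow> real"
  assumes mono: "\<And>x y. 0 \<le> x \<Longrightarrow> x \<le> y \<Longrightarrow> f y \<le> f x" and h: "0 < h"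
  shows "integral {0..real N * h} f \<le> h * (\<Sum>k<N. f (real k * h))"
proof (induction N)
  case (Suc N)
  have int: "f integrable_on {x..y}" if "0 \<le> x" for x y
    by (rule antimono_integrable_on) (use mono that in auto)
  define p r where "p = real N * h" and "r = p + h"
  have pr: "0 \<le> p" "p \<le> r" and rS: "r = real (Suc N) * h"
    using h by (auto simp: p_def r_def algebra_simps)
  have "integral {p..r} f \<le> integral {p..r} (\<lambda>_. f p)"
    by (rule integral_le) (use int pr mono in auto)
  moreover have "integral {0..p} f + integral {p..r} f = integral {0..r} f"
    by (rule Henstock_Kurzweil_Integration.integral_combine) (use int pr in auto)
  moreover have "integral {p..r} (\<lambda>_. f p) = h * f p"
    using h by (auto simp: r_def)
  ultimately have "integral {0..real (Suc N) * h} f \<le> integral {0..real N * h} f + h * f (real N * h)"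
    unfolding rS[symmetric] p_def[symmetric] by linarith
  then show ?case
    using Suc.IH by (simp add: distrib_left del: of_nat_Suc)
qed simp

lemma integral_slice_profile:
  assumes "1 \<le> b"
  shows "integral {0..b} (slice_profile m) = slice_volume m"
proof -
  have int: "slice_profile m integrable_on {x..y}" if "0 \<le> x" for x y
    by (rule antimono_integrable_on) (use slice_profile_antimono that in auto)
  have "integral {1..b} (slice_profile m) = integral {1..b} (\<lambda>_. 0)"
    by (rule integral_spike[of "{1}"]) (auto simp: slice_profile_def)
  moreover have "integral {0..1} (slice_profile m) + integral {1..b} (slice_profile m)
      = integral {0..b} (slice_profile m)"
    by (rule Henstock_Kurzweil_Integration.integral_combine) (use int assms in auto)
  ultimately show ?thesis by (simp add: slice_volume_def)
qed

lemma slice_volume_pos: "0 < slice_volume m"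
proof -
  have "1/2 * (\<Sum>k=1..2. slice_profile m (real k * (1/2))) \<le> integral {0..real 2 * (1/2)} (slice_profile m)"
    by (rule lower_sum) (auto intro: slice_profile_antimono)
  then have "1/2 * (slice_profile m (1/2) + slice_profile m 1) \<le> slice_volume m"
    by (simp add: numeral_2_eq_2 slice_volume_def)
  moreover have "0 < slice_profile m (1/2)" "0 \<le> slice_profile m 1"
    by (auto simp: slice_profile_def power2_eq_square)
  ultimately show ?thesis by simp
qed

lemma orthant_volume_pos: "0 < orthant_volume m"
  by (induction m) (auto simp: slice_volume_pos)

lemma sum_slice_profile_le:
  assumes "0 < T" "T \<le> real N"
  shows "(\<Sum>k=1..N. slice_profile m (real k / T)) \<le> T * slice_volume m"
proof -
  have "1 / T * (\<Sum>k=1..N. slice_profile m (real k * (1 / T))) \<le> integral {0..real N * (1 / T)} (slice_profile m)"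
    by (rule lower_sum) (use assms in \<open>auto intro: slice_profile_antimono\<close>)
  also have "\<dots> = slice_volume m"
    by (rule integral_slice_profile) (use assms in auto)
  finally show ?thesis using assms by (simp add: field_simps)
qed

text \<open>The upper Riemann sum starts at \<open>k = 0\<close>, where the profile equals 1; this
  term is the loss of 1. The condition \<open>T \<le> real N\<close> makes the grid of mesh
  \<open>1 / T\<close> cover [0,1].\<close>

lemma sum_slice_profile_ge:
  assumes "0 < T" "T \<le> real N"
  shows "T * slice_volume m - 1 \<le> (\<Sum>k=1..N. slice_profile m (real k / T))"
proof -
  have "slice_volume m = integral {0..real N * (1 / T)} (slice_profile m)"
    by (rule integral_slice_profile[symmetric]) (use assms in auto)
  also have "\<dots> \<le> 1 / T * (\<Sum>k<N. slice_profile m (real k * (1 / T)))"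
    by (rule upper_sum) (use assms in \<open>auto intro: slice_profile_antimono\<close>)
  also have "(\<Sum>k<N. slice_profile m (real k * (1 / T))) \<le> (\<Sum>k\<le>N. slice_profile m (real k * (1 / T)))"
    by (rule sum_mono2) (use assms in \<open>auto intro: slice_profile_nonneg\<close>)
  also have "\<dots> = 1 + (\<Sum>k=1..N. slice_profile m (real k / T))"
    by (simp add: sum.atMost_shift slice_profile_0 sum.atLeast1_atMost_eq lessThan_Suc_atMost)
  finally show ?thesis using assms by (simp add: field_simps)
qed

text \<open>With y and z the square roots at u and v, v^2 - u^2 = (y - z)(y + z) \<le> 2(y - z),
  while y^m - z^m \<ge> (y - z) y^(m-1). The bound \<open>u \<le> 2/3\<close> keeps y above 1/2. For
  \<open>m = 0\<close> the profile is constant on [0,1] and nothing drops.\<close>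

lemma slice_profile_drop:
  assumes "0 \<le> u" "u \<le> v" "u \<le> 2/3" "v \<le> 1" "1 \<le> m"
  shows "(v\<^sup>2 - u\<^sup>2) * (1/2) ^ m \<le> slice_profile m u - slice_profile m v"
proof -
  obtain p where m: "m = Suc p" using assms(5) by (cases m) auto
  define y z where "y = sqrt (1 - u\<^sup>2)" and "z = sqrt (1 - v\<^sup>2)"
  have v1: "0 \<le> 1 - v\<^sup>2" "0 \<le> 1 - u\<^sup>2"
    using assms by (auto simp: power_le_one)
  have u2: "u\<^sup>2 \<le> (2/3)\<^sup>2" using assms by (intro power_mono) auto
  have uv: "u\<^sup>2 \<le> v\<^sup>2" using assms by (intro power_mono) auto
  have yz: "0 \<le> z" "z \<le> y" "y \<le> 1" "y\<^sup>2 = 1 - u\<^sup>2" "z\<^sup>2 = 1 - v\<^sup>2"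
    using uv v1 by (auto simp: y_def z_def)
  have "(1/2)\<^sup>2 \<le> 1 - u\<^sup>2" using u2 by (simp add: power2_eq_square)
  then have "1/2 \<le> y" unfolding y_def by (rule real_le_rsqrt)
  then have half: "(1/2) ^ p \<le> y ^ p" by (intro power_mono) auto
  have "v\<^sup>2 - u\<^sup>2 = (y - z) * (y + z)"
    using yz by (simp add: algebra_simps power2_eq_square)
  also have "\<dots> \<le> (y - z) * 2" using yz by (intro mult_left_mono) auto
  finally have "(v\<^sup>2 - u\<^sup>2) / 2 * (1/2) ^ p \<le> (y - z) * y ^ p"
    using half yz by (intro mult_mono) auto
  also have "\<dots> \<le> y ^ m - z ^ m"
  proof -
    have "z * z ^ p \<le> z * y ^ p" using yz by (intro mult_left_mono power_mono) auto
    then show ?thesis by (simp add: m algebra_simps)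
  qed
  finally show ?thesis
    using assms by (simp add: slice_profile_def m y_def z_def)
qed

text \<open>On the cells with midpoint at most 2/3 the k-th drop is at least a multiple of k / T^2.
  There are of order T such cells, so the drops add up to a constant independent of T. The bound
  \<open>3/4 \<le> T\<close> provides at least one such cell and keeps the three-quarter points
  below 1.\<close>

lemma sum_slice_profile_le_strict:
  assumes m: "1 \<le> m" and T: "3/4 \<le> T" and N: "T + 1 \<le> real N"
  shows "(\<Sum>k=1..N. slice_profile m (real k / T)) \<le> T * slice_volume m - (1/2) ^ m / 81"
proof -
  define h where "h = 1 / T"
  have h: "0 < h" "T * h = 1" using T by (auto simp: h_def)
  define D where "D k = slice_profile m ((real k - 1/2) * h) - slice_profile m ((real k - 1/4) * h)" for k
  \<comment> \<open>The largest k whose midpoint \<open>(real k - 1/2) * h\<close> is at most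
    2/3.\<close>
  define K where "K = nat \<lfloor>2/3 * T + 1/2\<rfloor>"
  have K: "1 \<le> K" "real K \<le> 2/3 * T + 1/2" "2/3 * T - 1/2 < real K"
    using T unfolding K_def by linarith+
  have "K \<le> N" using K N T by linarith
  have drop: "h\<^sup>2 * (real k / 4) * (1/2) ^ m \<le> D k" if k: "1 \<le> k" "k \<le> K" for k
  proof -
    have kT: "real k \<le> 2/3 * T + 1/2" "1 \<le> real k" using k K by linarith+
    have "(real k - 1/2) * h \<le> 2/3 * T * h" using kT h by (intro mult_right_mono) auto
    then have u: "(real k - 1/2) * h \<le> 2/3" by (simp only: mult.assoc h mult_1_right)
    have "(real k - 1/4) * h \<le> T * h" using kT h T by (intro mult_right_mono) auto
    then have v: "(real k - 1/4) * h \<le> 1" by (simp only: h)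
    \<comment> \<open>The difference of the two squares is k/2 - 3/16, which is at least k/4 because
      k \<ge> 1.\<close>
    have "h\<^sup>2 * (real k / 4) \<le> h\<^sup>2 * ((real k - 1/4)\<^sup>2 - (real k - 1/2)\<^sup>2)"
      using kT by (intro mult_left_mono) (auto simp: power2_eq_square algebra_simps)
    also have "\<dots> = ((real k - 1/4) * h)\<^sup>2 - ((real k - 1/2) * h)\<^sup>2"
      unfolding power_mult_distrib by (simp only: right_diff_distrib mult.commute)
    finally have "h\<^sup>2 * (real k / 4) * (1/2) ^ m
        \<le> (((real k - 1/4) * h)\<^sup>2 - ((real k - 1/2) * h)\<^sup>2) * (1/2) ^ m"
      by (intro mult_right_mono) auto
    also have "\<dots> \<le> D k"
      unfolding D_def by (rule slice_profile_drop) (use u v kT h m in \<open>auto intro: mult_right_mono\<close>)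
    finally show ?thesis .
  qed
  have Dpos: "0 \<le> D k" if "1 \<le> k" for k
    unfolding D_def using that h by (auto intro!: slice_profile_antimono mult_right_mono)
  have K2: "8/81 * T\<^sup>2 \<le> (\<Sum>k=1..K. real k)"
  proof -
    \<comment> \<open>The two lower bounds K > 2T/3 - 1/2 and K \<ge> 1 are combined with weights
      2/3 and 1/3.\<close>
    have "4/9 * T \<le> real K" using K by linarith
    then have "(4/9 * T)\<^sup>2 \<le> (real K)\<^sup>2" using T by (intro power_mono) auto
    moreover have "(\<Sum>k=1..K. real k) = real K * (real K + 1) / 2"
      by (induction K) (auto simp: field_simps)
    ultimately show ?thesis by (simp add: power2_eq_square field_simps)
  qed
  \<comment> \<open>The constant 81 arises here: 1/2 from the refined sum, 1/4 from the drop and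
    8/81 from the sum of the k multiply to 1/81.\<close>
  have "h * ((1/2) ^ m / 81) = h * h\<^sup>2 / 8 * (1/2) ^ m * (8/81 * T\<^sup>2)"
    using T by (simp add: h_def field_simps power2_eq_square)
  also have "\<dots> \<le> h * h\<^sup>2 / 8 * (1/2) ^ m * (\<Sum>k=1..K. real k)"
    using K2 h by (intro mult_left_mono) auto
  also have "\<dots> = h / 2 * (\<Sum>k=1..K. h\<^sup>2 * (real k / 4) * (1/2) ^ m)"
    by (simp add: sum_distrib_left sum_distrib_right mult_ac)
  also have "\<dots> \<le> h / 2 * (\<Sum>k=1..K. D k)"
    using h drop by (intro mult_left_mono sum_mono) auto
  also have "\<dots> \<le> h / 2 * (\<Sum>k=1..N. D k)"
    using h Dpos \<open>K \<le> N\<close> by (intro mult_left_mono sum_mono2) auto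
  finally have gain: "h * ((1/2) ^ m / 81) \<le> h / 2 * (\<Sum>k=1..N. D k)" .
  have "h * (\<Sum>k=1..N. slice_profile m (real k / T)) + h / 2 * (\<Sum>k=1..N. D k)
      = (\<Sum>k=1..N. h * slice_profile m (real k * h) + h / 2 * D k)"
    by (simp add: sum.distrib sum_distrib_left h_def)
  also have "\<dots> \<le> integral {0..real N * h} (slice_profile m)"
    unfolding D_def by (rule refined_lower_sum) (use h in \<open>auto intro: slice_profile_antimono\<close>)
  also have "\<dots> = slice_volume m"
    by (rule integral_slice_profile) (use N T in \<open>auto simp: h_def\<close>)
  also have "\<dots> = h * (T * slice_volume m)" using h by (simp add: mult_ac)
  finally have "h * (\<Sum>k=1..N. slice_profile m (real k / T)) \<le> h * (T * slice_volume m - (1/2) ^ m / 81)"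
    using gain by (simp add: algebra_simps)
  then show ?thesis using h by (simp add: mult_le_cancel_left_pos)
qed

subsection \<open>Lattice points with positive coordinates\<close>

text \<open>The parameter \<open>s\<close> is the square of the radius, so that fixing a coordinate
  merely subtracts from it. Arbitrary index sets make slices and coordinate faces instances of the
  same notion; \<open>X\<close> is \<open>UNIV\<close> for the full ellipsoid and
  \<open>{1..}\<close> for Dirichlet indices.\<close>

definition lattice_points :: "int set \<Rightarrow> 'i set \<Rightarrow> ('i \<Rightarrow> real) \<Rightarrow> real \<Rightarrow> ('i \<Rightarrow> int) set" where
  "lattice_points X I a s = {z \<in> I \<rightarrow>\<^sub>E X. (\<Sum>i\<in>I. (real_of_int (z i))\<^sup>2 / (a i)\<^sup>2) \<le> s}"

definition lattice_count :: "int set \<Rightarrow> 'i set \<Rightarrow> ('i \<Rightarrow> real) \<Rightarrow> real \<Rightarrow> real" where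
  "lattice_count X I a s = real (card (lattice_points X I a s))"

abbreviation positive_count :: "'i set \<Rightarrow> ('i \<Rightarrow> real) \<Rightarrow> real \<Rightarrow> real" where
  "positive_count \<equiv> lattice_count {1..}"

lemma lattice_points_empty: "lattice_points X {} a s = (if 0 \<le> s then {\<lambda>_. undefined} else {})"
  by (auto simp: lattice_points_def)

lemma lattice_points_neg: "s < 0 \<Longrightarrow> lattice_points X I a s = {}"
  unfolding lattice_points_def by (auto simp: not_le intro!: less_le_trans[OF _ sum_nonneg])

lemma lattice_count_neg: "s < 0 \<Longrightarrow> lattice_count X I a s = 0"
  by (simp add: lattice_count_def lattice_points_neg)

lemma lattice_count_nonneg: "0 \<le> lattice_count X I a s"
  by (simp add: lattice_count_def)

lemma abs_le_of_sum_le: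
  fixes a :: "'i \<Rightarrow> real" and z :: "'i \<Rightarrow> int"
  assumes "finite I" "i \<in> I" "0 < a i" "(\<Sum>i\<in>I. (real_of_int (z i))\<^sup>2 / (a i)\<^sup>2) \<le> s"
  shows "\<bar>real_of_int (z i)\<bar> \<le> a i * sqrt s"
proof -
  have "(real_of_int (z i))\<^sup>2 / (a i)\<^sup>2 \<le> (\<Sum>i\<in>I. (real_of_int (z i))\<^sup>2 / (a i)\<^sup>2)"
    by (rule member_le_sum) (use assms in auto)
  then have "(real_of_int (z i) / a i)\<^sup>2 \<le> s" using assms by (simp add: power_divide)
  then have "\<bar>real_of_int (z i) / a i\<bar> \<le> sqrt s" by (metis real_sqrt_abs real_sqrt_le_iff)
  then show ?thesis using assms(3) by (simp add: field_simps)
qed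

lemma lattice_points_insert:
  assumes "finite I" "j \<notin> I" "0 < a j" "a j * sqrt s \<le> real N"
  shows "lattice_points X (insert j I) a s =
    (\<lambda>(y, g). g(j := y)) `
      (SIGMA y:X \<inter> {- int N..int N}. lattice_points X I a (s - (real_of_int y)\<^sup>2 / (a j)\<^sup>2))"
    (is "?L = ?f ` ?S")
proof
  have upd: "(\<Sum>i\<in>I. (real_of_int ((g(j := y)) i))\<^sup>2 / (a i)\<^sup>2) = (\<Sum>i\<in>I. (real_of_int (g i))\<^sup>2 / (a i)\<^sup>2)"
    for g y using assms(2) by (intro sum.cong) auto
  show "?f ` ?S \<subseteq> ?L"
  proof
    fix z assume "z \<in> ?f ` ?S"
    then obtain y g where *: "z = g(j := y)" "y \<in> X" "g \<in> I \<rightarrow>\<^sub>E X"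
      "(\<Sum>i\<in>I. (real_of_int (g i))\<^sup>2 / (a i)\<^sup>2) \<le> s - (real_of_int y)\<^sup>2 / (a j)\<^sup>2"
      by (auto simp: lattice_points_def)
    then show "z \<in> ?L"
      using assms(1,2) upd[of g y] by (auto simp: lattice_points_def PiE_iff extensional_def)
  qed
  show "?L \<subseteq> ?f ` ?S"
  proof
    fix z assume z: "z \<in> ?L"
    then have "\<bar>real_of_int (z j)\<bar> \<le> a j * sqrt s"
      by (intro abs_le_of_sum_le[of "insert j I"]) (use assms in \<open>auto simp: lattice_points_def\<close>)
    then have "z j \<in> {- int N..int N}" using assms(4) by auto
    moreover have "z(j := undefined) \<in> lattice_points X I a (s - (real_of_int (z j))\<^sup>2 / (a j)\<^sup>2)"
      using z assms(1,2) upd[of z undefined]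
      by (auto simp: lattice_points_def PiE_iff extensional_def)
    ultimately show "z \<in> ?f ` ?S"
      using z by (intro image_eqI[of _ _ "(z j, z(j := undefined))"])
        (auto simp: lattice_points_def)
  qed
qed

lemma inj_on_fun_upd_lattice_points:
  assumes "j \<notin> I"
  shows "inj_on (\<lambda>(y, g). g(j := y)) (SIGMA y:Y. lattice_points X I a (t y))"
  \<comment> \<open>The dependent sum lies in a plain product; its factor at \<open>j\<close> is
    \<open>UNIV\<close> since \<open>Y\<close> is arbitrary.\<close>
  by (rule inj_on_subset[OF inj_combinator[OF assms, of "\<lambda>i. if i = j then UNIV else X"]])
    (use assms in \<open>auto simp: lattice_points_def PiE_iff extensional_def\<close>)

lemma finite_lattice_points:
  assumes "finite I" "\<forall>i\<in>I. 0 < a i"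
  shows "finite (lattice_points X I a s)"
  using assms
proof (induction I arbitrary: s rule: finite_induct)
  case empty
  then show ?case by (simp add: lattice_points_empty)
next
  case (insert j I)
  obtain N where "a j * sqrt s \<le> real N" using real_arch_simple by blast
  then show ?case
    by (subst lattice_points_insert) (use insert in \<open>auto intro!: finite_imageI finite_SigmaI\<close>)
qed

lemma lattice_count_insert:
  assumes "finite I" "j \<notin> I" "\<forall>i\<in>insert j I. 0 < a i" "a j * sqrt s \<le> real N"
  shows "lattice_count X (insert j I) a s =
    (\<Sum>y\<in>X \<inter> {- int N..int N}. lattice_count X I a (s - (real_of_int y)\<^sup>2 / (a j)\<^sup>2))"
  unfolding lattice_count_def using assms
  by (subst lattice_points_insert)
    (auto simp: card_image inj_on_fun_upd_lattice_points finite_lattice_points)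

lemma positive_count_insert:
  assumes "finite I" "j \<notin> I" "\<forall>i\<in>insert j I. 0 < a i" "a j * sqrt s \<le> real N"
  shows "positive_count (insert j I) a s = (\<Sum>k=1..N. positive_count I a (s - (real k)\<^sup>2 / (a j)\<^sup>2))"
proof -
  have "(\<Sum>y\<in>{1..} \<inter> {- int N..int N}. positive_count I a (s - (real_of_int y)\<^sup>2 / (a j)\<^sup>2))
      = (\<Sum>k=1..N. positive_count I a (s - (real k)\<^sup>2 / (a j)\<^sup>2))"
    by (rule sum.reindex_bij_witness[of _ int nat]) auto
  then show ?thesis using lattice_count_insert[OF assms] by simp
qed

text \<open>Slices depend on y only through y^2, so those at y and -y pair up, and the slice at 0
  remains.\<close>

lemma full_count_insert:
  assumes "finite I" "j \<notin> I" "\<forall>i\<in>insert j I. 0 < a i" "a j * sqrt s \<le> real N"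
  shows "lattice_count UNIV (insert j I) a s = lattice_count UNIV I a s
    + 2 * (\<Sum>k=1..N. lattice_count UNIV I a (s - (real k)\<^sup>2 / (a j)\<^sup>2))"
proof -
  define F where "F y = lattice_count UNIV I a (s - (real_of_int y)\<^sup>2 / (a j)\<^sup>2)" for y
  have "{- int N..int N} = {0} \<union> ({1..int N} \<union> {- int N.. -1})" by auto
  then have "sum F {- int N..int N} = F 0 + (sum F {1..int N} + sum F {- int N.. -1})"
    by (simp add: sum.union_disjoint)
  moreover have "sum F {1..int N} = (\<Sum>k=1..N. F (int k))"
    by (rule sum.reindex_bij_witness[of _ int nat]) auto
  moreover have "sum F {- int N.. -1} = (\<Sum>k=1..N. F (int k))"
    by (rule sum.reindex_bij_witness[of _ "\<lambda>k. - int k" "\<lambda>y. nat (- y)"]) (auto simp: F_def)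
  ultimately show ?thesis
    using lattice_count_insert[OF assms, of UNIV] by (simp add: F_def)
qed

text \<open>The points are grouped by the set of indices of their nonzero coordinates.\<close>

lemma full_count_eq_sum_positive_count:
  assumes "finite I" "\<forall>i\<in>I. 0 < a i"
  shows "lattice_count UNIV I a s = (\<Sum>J\<in>Pow I. 2 ^ card J * positive_count J a s)"
  using assms
proof (induction I arbitrary: s rule: finite_induct)
  case empty
  then show ?case by (simp add: lattice_count_def lattice_points_empty)
next
  case (insert j I)
  obtain N where N: "a j * sqrt s \<le> real N" using real_arch_simple by blast
  have IH: "lattice_count UNIV I a t = (\<Sum>J\<in>Pow I. 2 ^ card J * positive_count J a t)" for t
    using insert by simp
  have step: "2 ^ card (insert j J) * positive_count (insert j J) a s
      = 2 * (\<Sum>k=1..N. 2 ^ card J * positive_count J a (s - (real k)\<^sup>2 / (a j)\<^sup>2))"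
    if "J \<in> Pow I" for J
  proof -
    have "finite J" "j \<notin> J" "\<forall>i\<in>insert j J. 0 < a i"
      using that insert finite_subset by auto
    then show ?thesis
      using positive_count_insert[of J j a s N] N
      by (simp add: sum_distrib_left mult_ac)
  qed
  \<comment> \<open>Sets without \<open>j\<close> match the slice at height 0; sets with
    \<open>j\<close> match the slices at nonzero height, their extra factor 2 accounting for the
    sign.\<close>
  have "(\<Sum>J\<in>Pow (insert j I). 2 ^ card J * positive_count J a s)
      = (\<Sum>J\<in>Pow I. 2 ^ card J * positive_count J a s)
        + (\<Sum>J\<in>Pow I. 2 ^ card (insert j J) * positive_count (insert j J) a s)"
  proof -
    have "inj_on (insert j) (Pow I)" "Pow I \<inter> insert j ` Pow I = {}"
      using insert.hyps(2) by (auto simp: inj_on_def)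
    then show ?thesis
      unfolding Pow_insert using insert.hyps(1)
      by (subst sum.union_disjoint) (simp_all add: sum.reindex)
  qed
  also have "(\<Sum>J\<in>Pow I. 2 ^ card (insert j J) * positive_count (insert j J) a s)
      = (\<Sum>J\<in>Pow I. 2 * (\<Sum>k=1..N. 2 ^ card J * positive_count J a (s - (real k)\<^sup>2 / (a j)\<^sup>2)))"
    by (rule sum.cong) (use step in auto)
  also have "\<dots> = 2 * (\<Sum>k=1..N. lattice_count UNIV I a (s - (real k)\<^sup>2 / (a j)\<^sup>2))"
    unfolding IH sum_distrib_left by (rule sum.swap)
  finally show ?case
    using full_count_insert[OF insert.hyps insert.prems N] IH by simp
qed

section \<open>Volume bounds for positive counts, with boundary terms\<close>

text \<open>The slice of the ellipsoid at height x has radius sqrt s times the profile radius at x /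
  (b sqrt s). Both sides vanish beyond the ellipsoid, also for \<open>m = 0\<close>.\<close>

lemma sqrt_slice:
  assumes "0 < s" "0 < b" "0 \<le> x"
  shows "sqrt s ^ m * slice_profile m (x / (b * sqrt s))
    = (if 0 \<le> s - x\<^sup>2 / b\<^sup>2 then sqrt (s - x\<^sup>2 / b\<^sup>2) ^ m else 0)"
proof -
  have eq: "s - x\<^sup>2 / b\<^sup>2 = s * (1 - (x / (b * sqrt s))\<^sup>2)"
    using assms by (simp add: power_divide power_mult_distrib field_simps)
  have "x / (b * sqrt s) \<le> 1 \<longleftrightarrow> (x / (b * sqrt s))\<^sup>2 \<le> 1"
    using assms by (simp add: abs_square_le_1 del: divide_le_eq_1_pos)
  also have "\<dots> \<longleftrightarrow> 0 \<le> s - x\<^sup>2 / b\<^sup>2"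
    unfolding eq using assms by (simp add: zero_le_mult_iff)
  finally show ?thesis
    unfolding slice_profile_def eq using assms
    by (simp add: real_sqrt_mult power_mult_distrib)
qed

text \<open>By induction the slices are bounded by their volumes. These decrease with the height and
  the heights start at 1, so their sum is a lower Riemann sum of the volume.\<close>

lemma positive_count_le:
  assumes "finite I" "\<forall>i\<in>I. 0 < a i" "0 \<le> s"
  shows "positive_count I a s \<le> orthant_volume (card I) * (\<Prod>i\<in>I. a i) * sqrt s ^ card I"
  using assms
proof (induction I arbitrary: s rule: finite_induct)
  case empty
  then show ?case by (simp add: lattice_count_def lattice_points_empty)
next
  case (insert j I)
  obtain N where N: "a j * sqrt s \<le> real N" using real_arch_simple by blast
  define V where "V = orthant_volume (card I) * (\<Prod>i\<in>I. a i)"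
  have V: "0 < V" using insert.prems by (auto simp: V_def orthant_volume_pos intro!: mult_pos_pos prod_pos)
  have aj: "0 < a j" using insert by auto
  show ?case
  proof (cases "s = 0")
    case True
    then show ?thesis
      using positive_count_insert[OF insert.hyps insert.prems(1), of s 0] insert.hyps by simp
  next
    case False
    then have s: "0 < s" using insert by auto
    define T where "T = a j * sqrt s"
    have T: "0 < T" "T \<le> real N" using N aj s by (auto simp: T_def)
    have "positive_count (insert j I) a s = (\<Sum>k=1..N. positive_count I a (s - (real k)\<^sup>2 / (a j)\<^sup>2))"
      using positive_count_insert[OF insert.hyps insert.prems(1) N] .
    also have "\<dots> \<le> (\<Sum>k=1..N. V * (sqrt s ^ card I * slice_profile (card I) (real k / T)))"
    proof (rule sum_mono)
      fix k
      show "positive_count I a (s - (real k)\<^sup>2 / (a j)\<^sup>2)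
          \<le> V * (sqrt s ^ card I * slice_profile (card I) (real k / T))"
        unfolding T_def sqrt_slice[OF s aj of_nat_0_le_iff]
        using insert by (auto simp: lattice_count_neg V_def)
    qed
    also have "\<dots> = V * sqrt s ^ card I * (\<Sum>k=1..N. slice_profile (card I) (real k / T))"
      by (simp add: sum_distrib_left mult_ac)
    also have "\<dots> \<le> V * sqrt s ^ card I * (T * slice_volume (card I))"
      using V s T by (intro mult_left_mono sum_slice_profile_le) auto
    also have "\<dots> = orthant_volume (card (insert j I)) * (\<Prod>i\<in>insert j I. a i) * sqrt s ^ card (insert j I)"
      using insert.hyps by (simp add: V_def T_def mult_ac)
    finally show ?thesis .
  qed
qed

text \<open>Only the summation over \<open>j\<close> uses the strict Riemann bound, with T = a j
  sqrt s. The subtracted term is a fixed fraction of the volume of the section at height 0. When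
  \<open>j\<close> is the shortest side of a unit cuboid, that section is large. In dimension one
  there is no gain, hence \<open>I \<noteq> {}\<close>.\<close>

lemma positive_count_insert_le:
  assumes "finite I" "j \<notin> I" "\<forall>i\<in>insert j I. 0 < a i" "0 < s" "I \<noteq> {}" "3/4 \<le> a j * sqrt s"
  shows "positive_count (insert j I) a s
    \<le> orthant_volume (card I + 1) * (\<Prod>i\<in>insert j I. a i) * sqrt s ^ (card I + 1)
      - orthant_volume (card I) * (1/2) ^ card I / 81 * (\<Prod>i\<in>I. a i) * sqrt s ^ card I"
proof -
  define V where "V = orthant_volume (card I) * (\<Prod>i\<in>I. a i)"
  have V: "0 < V" using assms by (auto simp: V_def orthant_volume_pos intro!: mult_pos_pos prod_pos)
  define T where "T = a j * sqrt s"
  obtain N where N: "T + 1 \<le> real N" using real_arch_simple by blast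
  have aj: "0 < a j" using assms by auto
  have "positive_count (insert j I) a s = (\<Sum>k=1..N. positive_count I a (s - (real k)\<^sup>2 / (a j)\<^sup>2))"
    by (rule positive_count_insert) (use assms N in \<open>auto simp: T_def\<close>)
  also have "\<dots> \<le> (\<Sum>k=1..N. V * (sqrt s ^ card I * slice_profile (card I) (real k / T)))"
  proof (rule sum_mono)
    fix k
    show "positive_count I a (s - (real k)\<^sup>2 / (a j)\<^sup>2)
        \<le> V * (sqrt s ^ card I * slice_profile (card I) (real k / T))"
      unfolding T_def sqrt_slice[OF assms(4) aj of_nat_0_le_iff]
      using assms by (auto simp: lattice_count_neg V_def intro!: positive_count_le)
  qed
  also have "\<dots> = V * sqrt s ^ card I * (\<Sum>k=1..N. slice_profile (card I) (real k / T))"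
    by (simp add: sum_distrib_left mult_ac)
  also have "\<dots> \<le> V * sqrt s ^ card I * (T * slice_volume (card I) - (1/2) ^ card I / 81)"
  proof (intro mult_left_mono sum_slice_profile_le_strict)
    show "1 \<le> card I" using assms by (simp add: Suc_le_eq card_gt_0_iff)
  qed (use V assms N in \<open>auto simp: T_def\<close>)
  also have "\<dots> = orthant_volume (card I + 1) * (\<Prod>i\<in>insert j I. a i) * sqrt s ^ (card I + 1)
      - orthant_volume (card I) * (1/2) ^ card I / 81 * (\<Prod>i\<in>I. a i) * sqrt s ^ card I"
    using assms(1,2) by (simp add: V_def T_def algebra_simps)
  finally show ?thesis .
qed

text \<open>The factor \<open>card I\<close> makes the error vanish for \<open>I = {}\<close>, where the exponent is truncated.\<close>

lemma positive_count_ge: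
  assumes "finite I" "0 \<le> M"
  shows "\<exists>C\<ge>0. \<forall>a s. (\<forall>i\<in>I. 0 < a i \<and> a i \<le> M) \<and> 0 \<le> s \<longrightarrow>
    orthant_volume (card I) * (\<Prod>i\<in>I. a i) * sqrt s ^ card I - C * real (card I) * (1 + sqrt s) ^ (card I - 1)
      \<le> positive_count I a s"
  using assms
proof (induction I rule: finite_induct)
  case empty
  then show ?case by (auto simp: lattice_count_def lattice_points_empty)
next
  case (insert j I)
  define m where "m = card I"
  obtain C where C: "0 \<le> C" and IH: "\<And>a s. (\<forall>i\<in>I. 0 < a i \<and> a i \<le> M) \<Longrightarrow> 0 \<le> s \<Longrightarrow>
    orthant_volume m * (\<Prod>i\<in>I. a i) * sqrt s ^ m - C * real m * (1 + sqrt s) ^ (m - 1)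
      \<le> positive_count I a s"
    using insert by (auto simp: m_def)
  have M: "0 \<le> M" by fact
  \<comment> \<open>The first summand collects the errors of at most (M + 1)(1 + sqrt s) slices, the
    second the loss of 1 in the Riemann sum, weighted by the section at height 0.\<close>
  define C' where "C' = (M + 1) * C + orthant_volume m * M ^ m"
  have C'0: "0 \<le> C'" using C M by (auto simp: C'_def orthant_volume_pos less_imp_le)
  have "orthant_volume (Suc m) * (\<Prod>i\<in>insert j I. a i) * sqrt s ^ Suc m - C' * real (Suc m) * (1 + sqrt s) ^ m
      \<le> positive_count (insert j I) a s"
    if a: "\<forall>i\<in>insert j I. 0 < a i \<and> a i \<le> M" and s0: "0 \<le> s" for a s
  proof (cases "s = 0")
    case True
    then have "orthant_volume (Suc m) * (\<Prod>i\<in>insert j I. a i) * sqrt s ^ Suc m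
        - C' * real (Suc m) * (1 + sqrt s) ^ m \<le> 0"
      using C'0 by simp
    then show ?thesis using lattice_count_nonneg by (rule order_trans)
  next
    case False
    then have s: "0 < s" using s0 by auto
    have aj: "0 < a j" "a j \<le> M" using a by auto
    define V where "V = orthant_volume m * (\<Prod>i\<in>I. a i)"
    have V: "0 < V" using a by (auto simp: V_def orthant_volume_pos intro!: mult_pos_pos prod_pos)
    have "(\<Prod>i\<in>I. a i) \<le> (\<Prod>i\<in>I. M)" using a by (intro prod_mono) (auto simp: less_imp_le)
    then have VM: "V \<le> orthant_volume m * M ^ m"
      by (auto simp: V_def m_def orthant_volume_pos less_imp_le intro!: mult_left_mono)
    define T where "T = a j * sqrt s"
    define N where "N = nat \<lceil>T\<rceil>"
    \<comment> \<open>A common error bound for all slices, since none has a radius above sqrt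
      s.\<close>
    define E where "E = C * real m * (1 + sqrt s) ^ (m - 1)"
    have E: "0 \<le> E" using C s by (auto simp: E_def)
    have T0: "0 < T" using aj s by (simp add: T_def)
    then have N: "T \<le> real N" "real N \<le> T + 1" unfolding N_def by linarith+
    have "T \<le> M * sqrt s" using aj s by (auto simp: T_def intro!: mult_right_mono)
    then have NM: "real N \<le> (M + 1) * (1 + sqrt s)" using N M s by (simp add: algebra_simps) (smt (verit) real_sqrt_ge_zero)
    have "real N * E \<le> (M + 1) * (1 + sqrt s) * E" using NM E by (rule mult_right_mono)
    also have "\<dots> = (M + 1) * C * (real m * (1 + sqrt s) ^ m)"
      by (cases m) (auto simp: E_def mult_ac)
    finally have err1: "real N * E \<le> (M + 1) * C * (real m * (1 + sqrt s) ^ m)" .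
    have err2: "V * sqrt s ^ m \<le> orthant_volume m * M ^ m * (1 + sqrt s) ^ m"
      using VM V s by (intro mult_mono power_mono) auto
    have "(M + 1) * C * (real m * (1 + sqrt s) ^ m) \<le> (M + 1) * C * (real (Suc m) * (1 + sqrt s) ^ m)"
      using M C s by (intro mult_left_mono mult_right_mono) auto
    moreover have "orthant_volume m * M ^ m * (1 + sqrt s) ^ m
        \<le> orthant_volume m * M ^ m * (real (Suc m) * (1 + sqrt s) ^ m)"
    proof (intro mult_left_mono)
      show "(1 + sqrt s) ^ m \<le> real (Suc m) * (1 + sqrt s) ^ m"
        using s by (simp add: distrib_right)
    qed (use M in \<open>auto simp: orthant_volume_pos less_imp_le\<close>)
    ultimately have err: "real N * E + V * sqrt s ^ m \<le> C' * real (Suc m) * (1 + sqrt s) ^ m"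
      using err1 err2 unfolding C'_def distrib_right mult.assoc by linarith
    have "orthant_volume (Suc m) * (\<Prod>i\<in>insert j I. a i) * sqrt s ^ Suc m - C' * real (Suc m) * (1 + sqrt s) ^ m
        \<le> V * sqrt s ^ m * (T * slice_volume m - 1) - real N * E"
      using err insert.hyps by (simp add: V_def T_def algebra_simps)
    also have "\<dots> \<le> V * sqrt s ^ m * (\<Sum>k=1..N. slice_profile m (real k / T)) - real N * E"
      using V s T0 N by (intro diff_right_mono mult_left_mono sum_slice_profile_ge) auto
    also have "\<dots> = (\<Sum>k=1..N. V * (sqrt s ^ m * slice_profile m (real k / T)) - E)"
      by (simp add: sum_subtractf sum_distrib_left mult_ac)
    also have "\<dots> \<le> (\<Sum>k=1..N. positive_count I a (s - (real k)\<^sup>2 / (a j)\<^sup>2))"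
    proof (rule sum_mono)
      fix k
      let ?s = "s - (real k)\<^sup>2 / (a j)\<^sup>2"
      show "V * (sqrt s ^ m * slice_profile m (real k / T)) - E \<le> positive_count I a ?s"
      proof (cases "0 \<le> ?s")
        case True
        have "(1 + sqrt ?s) ^ (m - 1) \<le> (1 + sqrt s) ^ (m - 1)"
          using True by (intro power_mono) auto
        then have "C * real m * (1 + sqrt ?s) ^ (m - 1) \<le> E"
          unfolding E_def using C by (intro mult_left_mono) auto
        moreover have "V * sqrt ?s ^ m - C * real m * (1 + sqrt ?s) ^ (m - 1) \<le> positive_count I a ?s"
          unfolding V_def by (rule IH) (use a True in auto)
        ultimately show ?thesis
          unfolding T_def sqrt_slice[OF s aj(1) of_nat_0_le_iff] using True by simp
      next
        case False
        then show ?thesis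
          unfolding T_def sqrt_slice[OF s aj(1) of_nat_0_le_iff]
          using E lattice_count_nonneg[of "{1..}" I a ?s] by simp
      qed
    qed
    also have "\<dots> = positive_count (insert j I) a s"
      using a N by (intro positive_count_insert[symmetric] insert.hyps) (auto simp: T_def)
    finally show ?thesis .
  qed
  then show ?case using C'0 insert.hyps by (intro exI[of _ C']) (auto simp: m_def)
qed

subsection \<open>From counting functions to Riesz means\<close>

lemma has_integral_step:
  fixes c M :: real
  assumes "0 \<le> c" "c \<le> M"
  shows "((\<lambda>y. if y \<in> {0..c} then 1 else 0) has_integral c) {0..M}"
proof -
  have "((\<lambda>y. 1::real) has_integral c) {0..c}"
    using has_integral_const_real[of "1::real" 0 c] assms by simp
  then show ?thesis
    by (subst has_integral_restrict) (use assms in auto)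
qed

text \<open>
  Layer cake: \<open>\<Sum>k. (\<mu> - f k)\<^sup>\<gamma>\<close> is the integral of \<open>y \<mapsto> card {k. f k \<le> \<mu> - y\<^bsup>1/\<gamma>\<^esup>}\<close>, so a
  bound for the difference of the counting functions integrates to one for the Riesz means.
\<close>

lemma riesz_sum_diff_le:
  fixes f :: "'a \<Rightarrow> real" and g :: "'b \<Rightarrow> real"
  assumes fin: "finite A" "finite B" and \<gamma>: "0 \<le> \<gamma>" and \<sigma>: "0 \<le> \<sigma>" "\<sigma> < \<mu>"
    and f: "\<And>k. k \<in> A \<Longrightarrow> 0 \<le> f k \<and> f k \<le> \<mu>" and g: "\<And>k. k \<in> B \<Longrightarrow> 0 \<le> g k \<and> g k \<le> \<mu>"
    and bound: "\<And>s. 0 \<le> s \<Longrightarrow> s \<le> \<mu> \<Longrightarrow>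
      real (card {k\<in>A. f k \<le> s}) - real (card {k\<in>B. g k \<le> s}) \<le> D - (if \<sigma> \<le> s then E else 0)"
  shows "(\<Sum>k\<in>A. if \<gamma> = 0 then 1 else (\<mu> - f k) powr \<gamma>) - (\<Sum>k\<in>B. if \<gamma> = 0 then 1 else (\<mu> - g k) powr \<gamma>)
    \<le> D * \<mu> powr \<gamma> - E * (\<mu> - \<sigma>) powr \<gamma>"
proof (cases "\<gamma> = 0")
  case True
  \<comment> \<open>For exponent 0 the hypothesis at s = \<mu> is the claim; \<open>E\<close> enters
    because \<sigma> < \<mu>.\<close>
  have "{k\<in>A. f k \<le> \<mu>} = A" "{k\<in>B. g k \<le> \<mu>} = B" using f g by auto
  then show ?thesis using True bound[of \<mu>] \<sigma> by simp
next
  case False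
  then have \<gamma>0: "0 < \<gamma>" using \<gamma> by simp
  \<comment> \<open>No summand exceeds this value, so all layers lie in [0,M].\<close>
  define M where "M = \<mu> powr \<gamma>"
  have le_powr_iff: "y \<le> z powr \<gamma> \<longleftrightarrow> y powr (1 / \<gamma>) \<le> z" if "0 \<le> y" "0 \<le> z" for y z
  proof
    assume "y \<le> z powr \<gamma>"
    then have "y powr (1 / \<gamma>) \<le> (z powr \<gamma>) powr (1 / \<gamma>)" using that \<gamma>0 by (intro powr_mono2) auto
    then show "y powr (1 / \<gamma>) \<le> z" using that \<gamma>0 by (simp add: powr_powr)
  next
    assume "y powr (1 / \<gamma>) \<le> z"
    then have "(y powr (1 / \<gamma>)) powr \<gamma> \<le> z powr \<gamma>" using \<gamma>0 by (intro powr_mono2) auto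
    then show "y \<le> z powr \<gamma>" using that \<gamma>0 by (simp add: powr_powr)
  qed
  define F where "F y = (\<Sum>k\<in>A. if y \<in> {0..(\<mu> - f k) powr \<gamma>} then 1 else (0::real))" for y
  define G where "G y = (\<Sum>k\<in>B. if y \<in> {0..(\<mu> - g k) powr \<gamma>} then 1 else (0::real))" for y
  have "(F has_integral (\<Sum>k\<in>A. (\<mu> - f k) powr \<gamma>)) {0..M}"
    unfolding F_def
    using fin f \<gamma> unfolding M_def
    by (intro has_integral_sum has_integral_step) (auto intro!: powr_mono2)
  moreover have "(G has_integral (\<Sum>k\<in>B. (\<mu> - g k) powr \<gamma>)) {0..M}"
    unfolding G_def
    using fin g \<gamma> unfolding M_def
    by (intro has_integral_sum has_integral_step) (auto intro!: powr_mono2)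
  ultimately have "((\<lambda>y. F y - G y)
      has_integral ((\<Sum>k\<in>A. (\<mu> - f k) powr \<gamma>) - (\<Sum>k\<in>B. (\<mu> - g k) powr \<gamma>))) {0..M}"
    by (rule has_integral_diff)
  \<comment> \<open>The layer y counts values up to s = \<mu> - y powr (1 / \<gamma>), and \<sigma>
    \<le> s holds exactly when y \<le> (\<mu> - \<sigma>) powr \<gamma>.\<close>
  moreover have "((\<lambda>y. D - E * (if y \<in> {0..(\<mu> - \<sigma>) powr \<gamma>} then 1 else 0))
      has_integral (D * M - E * (\<mu> - \<sigma>) powr \<gamma>)) {0..M}"
  proof (intro has_integral_diff has_integral_mult_right has_integral_step)
    show "((\<lambda>y. D) has_integral D * M) {0..M}"
      using has_integral_const_real[of D 0 M] by (simp add: M_def mult.commute)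
  qed (use \<sigma> \<gamma> in \<open>auto simp: M_def intro!: powr_mono2\<close>)
  ultimately have "(\<Sum>k\<in>A. (\<mu> - f k) powr \<gamma>) - (\<Sum>k\<in>B. (\<mu> - g k) powr \<gamma>) \<le> D * M - E * (\<mu> - \<sigma>) powr \<gamma>"
  proof (rule has_integral_le)
    fix y assume y: "y \<in> {0..M}"
    then have "y powr (1 / \<gamma>) \<le> \<mu>" using \<sigma> le_powr_iff[of y \<mu>] by (auto simp: M_def)
    moreover have "y \<in> {0..(\<mu> - \<sigma>) powr \<gamma>} \<longleftrightarrow> \<sigma> \<le> \<mu> - y powr (1 / \<gamma>)"
      using y \<sigma> by (auto simp: le_powr_iff)
    moreover have "F y = real (card {k\<in>A. f k \<le> \<mu> - y powr (1 / \<gamma>)})"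
    proof -
      have "F y = (\<Sum>k\<in>A. if f k \<le> \<mu> - y powr (1 / \<gamma>) then 1 else (0::real))"
        unfolding F_def using f y by (intro sum.cong) (auto simp: le_powr_iff)
      then show ?thesis using fin by (simp add: sum.If_cases Int_def)
    qed
    moreover have "G y = real (card {k\<in>B. g k \<le> \<mu> - y powr (1 / \<gamma>)})"
    proof -
      have "G y = (\<Sum>k\<in>B. if g k \<le> \<mu> - y powr (1 / \<gamma>) then 1 else (0::real))"
        unfolding G_def using g y by (intro sum.cong) (auto simp: le_powr_iff)
      then show ?thesis using fin by (simp add: sum.If_cases Int_def)
    qed
    ultimately show "F y - G y \<le> D - E * (if y \<in> {0..(\<mu> - \<sigma>) powr \<gamma>} then 1 else 0)"
      using bound[of "\<mu> - y powr (1 / \<gamma>)"] y by auto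
  qed
  then show ?thesis using False by (simp add: M_def)
qed

section \<open>Eigenvalue counts and comparison of Riesz means\<close>

lemma dirichlet_count:
  "real (card {k \<in> dirichlet_indices n. dirichlet_eigenvalue n a k \<le> s}) = positive_count {1..n} a (s / pi\<^sup>2)"
proof -
  have ev: "dirichlet_eigenvalue n a k \<le> s \<longleftrightarrow> (\<Sum>i=1..n. (real (k i))\<^sup>2 / (a i)\<^sup>2) \<le> s / pi\<^sup>2" for k
  proof -
    have "dirichlet_eigenvalue n a k = pi\<^sup>2 * (\<Sum>i=1..n. (real (k i))\<^sup>2 / (a i)\<^sup>2)"
      by (simp add: dirichlet_eigenvalue_def sum_distrib_left)
    then show ?thesis by (simp add: field_simps)
  qed
  have "bij_betw (\<lambda>k. restrict (\<lambda>i. int (k i)) {1..n})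
      {k \<in> dirichlet_indices n. dirichlet_eigenvalue n a k \<le> s} (lattice_points {1..} {1..n} a (s / pi\<^sup>2))"
    unfolding ev
  proof (rule bij_betw_byWitness[where f' = "\<lambda>z. restrict (\<lambda>i. nat (z i)) {1..n}"])
    show "\<forall>k\<in>{k \<in> dirichlet_indices n. (\<Sum>i=1..n. (real (k i))\<^sup>2 / (a i)\<^sup>2) \<le> s / pi\<^sup>2}.
        (\<lambda>i\<in>{1..n}. nat ((\<lambda>i\<in>{1..n}. int (k i)) i)) = k"
      by (auto simp: dirichlet_indices_def PiE_iff extensional_def)
    show "\<forall>z\<in>lattice_points {1..} {1..n} a (s / pi\<^sup>2).
        (\<lambda>i\<in>{1..n}. int ((\<lambda>i\<in>{1..n}. nat (z i)) i)) = z"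
    proof
      fix z assume z: "z \<in> lattice_points {1..} {1..n} a (s / pi\<^sup>2)"
      have "1 \<le> z i" if "i \<in> {1..n}" for i
        using z that by (auto simp: lattice_points_def PiE_iff)
      then have "0 \<le> z i" if "i \<in> {1..n}" for i
        using that by force
      then show "(\<lambda>i\<in>{1..n}. int ((\<lambda>i\<in>{1..n}. nat (z i)) i)) = z"
        using z by (auto simp: lattice_points_def PiE_iff extensional_def)
    qed
    show "(\<lambda>k. \<lambda>i\<in>{1..n}. int (k i)) ` {k \<in> dirichlet_indices n. (\<Sum>i=1..n. (real (k i))\<^sup>2 / (a i)\<^sup>2) \<le> s / pi\<^sup>2}
        \<subseteq> lattice_points {1..} {1..n} a (s / pi\<^sup>2)"
      by (force simp: lattice_points_def dirichlet_indices_def PiE_iff)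
    show "(\<lambda>z. \<lambda>i\<in>{1..n}. nat (z i)) ` lattice_points {1..} {1..n} a (s / pi\<^sup>2)
        \<subseteq> {k \<in> dirichlet_indices n. (\<Sum>i=1..n. (real (k i))\<^sup>2 / (a i)\<^sup>2) \<le> s / pi\<^sup>2}"
    proof clarify
      fix z assume z: "z \<in> lattice_points {1..} {1..n} a (s / pi\<^sup>2)"
      have pos: "1 \<le> z i" if "i \<in> {1..n}" for i
        using z that by (auto simp: lattice_points_def PiE_iff)
      have "(\<Sum>i=1..n. (real ((\<lambda>i\<in>{1..n}. nat (z i)) i))\<^sup>2 / (a i)\<^sup>2)
          = (\<Sum>i=1..n. (real_of_int (z i))\<^sup>2 / (a i)\<^sup>2)"
      proof (intro sum.cong refl)
        fix i assume "i \<in> {1..n}"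
        with pos[of i] show "(real ((\<lambda>i\<in>{1..n}. nat (z i)) i))\<^sup>2 / (a i)\<^sup>2 = (real_of_int (z i))\<^sup>2 / (a i)\<^sup>2"
          by simp
      qed
      moreover have "(\<lambda>i\<in>{1..n}. nat (z i)) \<in> dirichlet_indices n"
        using pos by (force simp: dirichlet_indices_def PiE_iff)
      ultimately show "(\<lambda>i\<in>{1..n}. nat (z i)) \<in> dirichlet_indices n
          \<and> (\<Sum>i=1..n. (real ((\<lambda>i\<in>{1..n}. nat (z i)) i))\<^sup>2 / (a i)\<^sup>2) \<le> s / pi\<^sup>2"
        using z by (simp add: lattice_points_def)
    qed
  qed
  then show ?thesis by (simp add: lattice_count_def bij_betw_same_card)
qed

text \<open>If \<open>a\<close> is at least as good as \<open>b\<close>, a deficit \<open>E\<close>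
  of its counts near the top of the spectral range is paid for by the surplus \<open>D\<close>
  allowed everywhere. The cut t = 3/4 sqrt \<mu> / \<pi> means \<sigma> = 9/16 \<mu> in the layer
  cake, and the remaining 7/16 \<mu> yields the factor (16/7) powr \<gamma>.\<close>

lemma riesz_mean_comparison:
  assumes "unit_cuboid n a" "unit_cuboid n b" and \<gamma>: "0 \<le> \<gamma>" and \<mu>: "0 < \<mu>"
    and le: "riesz_mean n \<gamma> \<mu> b \<le> riesz_mean n \<gamma> \<mu> a"
    and bound: "\<And>t. 0 \<le> t \<Longrightarrow> t \<le> sqrt \<mu> / pi \<Longrightarrow>
      positive_count {1..n} a (t\<^sup>2) - positive_count {1..n} b (t\<^sup>2)
        \<le> D - (if 3/4 * (sqrt \<mu> / pi) \<le> t then E else 0)"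
  shows "E \<le> (16/7) powr \<gamma> * D"
proof -
  have "riesz_mean n \<gamma> \<mu> a - riesz_mean n \<gamma> \<mu> b \<le> D * \<mu> powr \<gamma> - E * (\<mu> - 9/16 * \<mu>) powr \<gamma>"
    unfolding riesz_mean_def
  proof (rule riesz_sum_diff_le)
    fix s assume s: "0 \<le> s" "s \<le> \<mu>"
    have count: "real (card {k \<in> {k \<in> dirichlet_indices n. dirichlet_eigenvalue n c k \<le> \<mu>}.
        dirichlet_eigenvalue n c k \<le> s}) = positive_count {1..n} c ((sqrt s / pi)\<^sup>2)" for c
    proof -
      have "{k \<in> {k \<in> dirichlet_indices n. dirichlet_eigenvalue n c k \<le> \<mu>}. dirichlet_eigenvalue n c k \<le> s}
          = {k \<in> dirichlet_indices n. dirichlet_eigenvalue n c k \<le> s}"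
        using s by auto
      then show ?thesis using s by (simp add: dirichlet_count power_divide)
    qed
    have "9/16 * \<mu> \<le> s \<longleftrightarrow> sqrt (9/16 * \<mu>) \<le> sqrt s" by simp
    also have "sqrt (9/16 * \<mu>) = 3/4 * sqrt \<mu>"
      by (simp add: real_sqrt_mult real_sqrt_divide del: times_divide_eq_left)
    finally have "9/16 * \<mu> \<le> s \<longleftrightarrow> 3/4 * (sqrt \<mu> / pi) \<le> sqrt s / pi"
      by (simp add: field_simps)
    then show "real (card {k \<in> {k \<in> dirichlet_indices n. dirichlet_eigenvalue n a k \<le> \<mu>}.
          dirichlet_eigenvalue n a k \<le> s})
        - real (card {k \<in> {k \<in> dirichlet_indices n. dirichlet_eigenvalue n b k \<le> \<mu>}.
          dirichlet_eigenvalue n b k \<le> s})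
        \<le> D - (if 9/16 * \<mu> \<le> s then E else 0)"
      unfolding count using bound[of "sqrt s / pi"] s by (simp add: divide_right_mono)
  qed (use assms finite_dirichlet_indices_le in \<open>auto simp: dirichlet_eigenvalue_def intro!: sum_nonneg\<close>)
  then have "E * (7/16 * \<mu>) powr \<gamma> \<le> D * \<mu> powr \<gamma>" using le by simp
  moreover have "\<mu> powr \<gamma> = (16/7) powr \<gamma> * (7/16 * \<mu>) powr \<gamma>"
    by (subst powr_mult[symmetric]) (use \<mu> in auto)
  ultimately have "E * (7/16 * \<mu>) powr \<gamma> \<le> (16/7) powr \<gamma> * D * (7/16 * \<mu>) powr \<gamma>"
    by (simp add: mult_ac)
  then show ?thesis using \<mu> by (simp add: mult_le_cancel_right)
qed

text \<open>
  For the unit cube the count is constant for \<open>t\<^sup>2\<close> in \<open>[m, m + 1)\<close>, while the volume term grows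
  by at least a multiple of \<open>m\<^bsup>(n-2)/2\<^esup>\<close> there.
\<close>

lemma admissible_exponent_ge:
  assumes n: "2 \<le> n" and adm: "admissible_exponent n \<theta>"
  shows "real n - 2 \<le> \<theta>"
proof (rule ccontr)
  assume "\<not> real n - 2 \<le> \<theta>"
  then have \<theta>: "\<theta> < real n - 2" by simp
  obtain C T where CT: "\<And>a t. (\<forall>i\<in>{1..n}. a i \<in> {1}) \<Longrightarrow> T \<le> t \<Longrightarrow>
      \<bar>real (ellipsoid_count n a t) - unit_ball_vol (real n) * t ^ n * (\<Prod>i=1..n. a i)\<bar> \<le> C * t powr \<theta>"
    using adm unfolding admissible_exponent_def by (metis compact_sing greaterThan_iff singleton_iff subsetI zero_less_one)
  define \<omega> where "\<omega> = unit_ball_vol (real n)"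
  have \<omega>: "0 < \<omega>" by (simp add: \<omega>_def)
  have count: "ellipsoid_count n (\<lambda>_. 1) (sqrt (real m + 1/2)) = ellipsoid_count n (\<lambda>_. 1) (sqrt (real m))" for m
  proof -
    have "(\<Sum>i=1..n. (real_of_int (z i))\<^sup>2 / 1\<^sup>2) \<le> real m + 1/2 \<longleftrightarrow> (\<Sum>i=1..n. (real_of_int (z i))\<^sup>2 / 1\<^sup>2) \<le> real m"
      for z :: "nat \<Rightarrow> int"
    proof -
      have sum: "(\<Sum>i=1..n. (real_of_int (z i))\<^sup>2 / 1\<^sup>2) = real_of_int (\<Sum>i=1..n. (z i)\<^sup>2)" by simp
      have "real_of_int w \<le> real m + 1/2 \<longleftrightarrow> real_of_int w \<le> real m" for w
      proof
        assume "real_of_int w \<le> real m + 1/2"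
        then have "w \<le> int m" by linarith
        then show "real_of_int w \<le> real m" by linarith
      qed simp
      then show ?thesis unfolding sum .
    qed
    then show ?thesis unfolding ellipsoid_count_def by simp
  qed
  have ineq: "\<omega> / 2 * sqrt (real m) ^ (n - 2) \<le> C * sqrt (real m) powr \<theta> + C * sqrt (real m + 1/2) powr \<theta>"
    if m: "T \<le> sqrt (real m)" for m
  proof -
    let ?x = "sqrt (real m)" and ?y = "sqrt (real m + 1/2)"
    have xy: "0 \<le> ?x" "?x \<le> ?y" by auto
    have n2: "n = 2 + (n - 2)" using n by simp
    \<comment> \<open>As \<open>?y\<^sup>2\<close> is \<open>?x\<^sup>2\<close> plus 1/2, the n-th
      powers differ by at least half of \<open>?x ^ (n - 2)\<close>. The two counts agree, so their
      errors must absorb this.\<close>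
    have "(real m + 1/2) * ?x ^ (n - 2) \<le> ?y\<^sup>2 * ?y ^ (n - 2)"
      using xy by (intro mult_mono power_mono) auto
    also have "\<dots> = ?y ^ n" by (metis n2 power_add)
    finally have "real m * ?x ^ (n - 2) + ?x ^ (n - 2) / 2 \<le> ?y ^ n" by (simp add: algebra_simps)
    moreover have "real m * ?x ^ (n - 2) = ?x ^ n"
      by (subst (2) n2) (simp add: power_add)
    ultimately have "?x ^ (n - 2) / 2 \<le> ?y ^ n - ?x ^ n" by linarith
    then have "\<omega> * (?x ^ (n - 2) / 2) \<le> \<omega> * (?y ^ n - ?x ^ n)" using \<omega> by (intro mult_left_mono) auto
    moreover have "\<bar>real (ellipsoid_count n (\<lambda>_. 1) ?x) - \<omega> * ?x ^ n\<bar> \<le> C * ?x powr \<theta>"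
      using CT[of "\<lambda>_. 1" ?x] m by (simp add: \<omega>_def)
    moreover have "\<bar>real (ellipsoid_count n (\<lambda>_. 1) ?x) - \<omega> * ?y ^ n\<bar> \<le> C * ?y powr \<theta>"
      using CT[of "\<lambda>_. 1" ?y] m xy by (simp add: \<omega>_def count)
    ultimately show ?thesis by (simp add: algebra_simps)
  qed
  define d where "d = real n - 2 - \<theta>"
  have d: "0 < d" using \<theta> by (simp add: d_def)
  have "eventually (\<lambda>m. \<omega> / 2 * sqrt (real m) powr (real n - 2)
      \<le> C * sqrt (real m) powr \<theta> + C * sqrt (real m + 1/2) powr \<theta>) sequentially"
  proof -
    have "eventually (\<lambda>m. T \<le> sqrt (real m)) sequentially"
      by (intro filterlim_at_top[THEN iffD1, rule_format] filterlim_compose[OF sqrt_at_top] filterlim_real_sequentially)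
    moreover have "eventually (\<lambda>m. 1 \<le> m) sequentially" by (rule eventually_ge_at_top)
    ultimately show ?thesis
    proof eventually_elim
      case (elim m)
      then have "sqrt (real m) powr (real n - 2) = sqrt (real m) ^ (n - 2)"
        using n by (subst powr_realpow[symmetric]) (auto simp: of_nat_diff)
      then show ?case using ineq[of m] elim by simp
    qed
  qed
  moreover have "eventually (\<lambda>m. C * sqrt (real m) powr \<theta> + C * sqrt (real m + 1/2) powr \<theta>
      < \<omega> / 2 * sqrt (real m) powr (real n - 2)) sequentially"
  proof -
    \<comment> \<open>The exponent n - 2 is written as \<theta> + d so that the gap d > 0 is visible
      to \<open>real_asymp\<close>.\<close>
    have "eventually (\<lambda>m. C * sqrt (real m) powr \<theta> + C * sqrt (real m + 1/2) powr \<theta>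
      < \<omega> / 2 * sqrt (real m) powr (\<theta> + d)) sequentially"
      using \<omega> d by real_asymp
    then show ?thesis by (simp add: d_def)
  qed
  ultimately have "eventually (\<lambda>m. False) sequentially"
    by eventually_elim simp
  then show False by simp
qed

subsection \<open>Comparison with the cube\<close>

text \<open>The coordinate faces are sorted by codimension 0, 1 and at least 2: interior, facets
  carrying the boundary term, and a remainder of lower order.\<close>

lemma full_count_split:
  assumes "finite I" "\<forall>i\<in>I. 0 < a i"
  shows "lattice_count UNIV I a s = 2 ^ card I * positive_count I a s
    + (\<Sum>i\<in>I. 2 ^ (card I - 1) * positive_count (I - {i}) a s)
    + (\<Sum>J | J \<subseteq> I \<and> card J + 2 \<le> card I. 2 ^ card J * positive_count J a s)"
proof -
  let ?F = "\<lambda>J. 2 ^ card J * positive_count J a s"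
  define R where "R = {J. J \<subseteq> I \<and> card J + 2 \<le> card I}"
  define S where "S = (\<lambda>i. I - {i}) ` I"
  have card_S: "card (I - {i}) = card I - 1" if "i \<in> I" for i
    using that assms(1) by simp
  have pos: "0 < card I" if "i \<in> I" for i
    using that assms(1) card_gt_0_iff by blast
  have "J \<in> {I} \<union> (S \<union> R)" if J: "J \<subseteq> I" for J
  proof (cases "J = I")
    case False
    then obtain i where i: "i \<in> I" "i \<notin> J" using J by auto
    show ?thesis
    proof (cases "J = I - {i}")
      case True
      then show ?thesis using i by (auto simp: S_def)
    next
      case False
      then have "card J < card (I - {i})"
        using i J assms(1) by (intro psubset_card_mono) auto
      then show ?thesis using J card_S[OF i(1)] by (auto simp: R_def)
    qed
  qed auto
  then have Pow: "Pow I = {I} \<union> (S \<union> R)" by (auto simp: S_def R_def)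
  have "finite R" using assms(1) by (simp add: R_def)
  have disj: "S \<inter> R = {}" "I \<notin> S" "I \<notin> R"
    using card_S pos by (fastforce simp: S_def R_def)+
  have "finite S" using assms(1) by (simp add: S_def)
  have "(\<Sum>J\<in>Pow I. ?F J) = ?F I + (sum ?F S + sum ?F R)"
    unfolding Pow using \<open>finite R\<close> \<open>finite S\<close> disj
    by (simp add: sum.union_disjoint)
  moreover have "sum ?F S = (\<Sum>i\<in>I. ?F (I - {i}))"
    unfolding S_def by (subst sum.reindex) (auto simp: inj_on_def)
  moreover have "\<dots> = (\<Sum>i\<in>I. 2 ^ (card I - 1) * positive_count (I - {i}) a s)"
    by (rule sum.cong) (use card_S in auto)
  ultimately show ?thesis
    using full_count_eq_sum_positive_count[OF assms, of s] by (simp add: R_def)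
qed

lemma unit_cuboid_cube: "unit_cuboid n (\<lambda>_. 1)"
  by (simp add: unit_cuboid_def mono_on_def)

text \<open>This turns the facet volumes of the boundary term into the reciprocals 1 / a i.\<close>

lemma unit_cuboid_prod_remove:
  assumes "unit_cuboid n a" "i \<in> {1..n}"
  shows "(\<Prod>j\<in>{1..n} - {i}. a j) = 1 / a i"
proof -
  have "a i * (\<Prod>j\<in>{1..n} - {i}. a j) = 1" "0 < a i"
    using assms prod.remove[of "{1..n}" i a] by (auto simp: unit_cuboid_def)
  then show ?thesis by (simp add: field_simps)
qed

text \<open>Both full counts have the same volume term. Solving the split for the positive counts
  leaves the facets, whose weight 2^(n-1) against 2^n gives the factor 1/2. One-sided bounds
  suffice: from below for the faces of \<open>a\<close>, from above for those of the cube. Their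
  errors of order (1 + t)^(n-2) fit into (1 + t) powr \<theta>.\<close>

lemma positive_count_cuboid_cube_diff_le:
  assumes n: "2 \<le> n" and adm: "admissible_exponent n \<theta>" and M: "1 \<le> M"
  shows "\<exists>D T. \<forall>a t. unit_cuboid n a \<longrightarrow> (\<forall>i\<in>{1..n}. 1 / M \<le> a i \<and> a i \<le> M) \<longrightarrow> T \<le> t \<longrightarrow>
    positive_count {1..n} a (t\<^sup>2) - positive_count {1..n} (\<lambda>_. 1) (t\<^sup>2)
      \<le> D * (1 + t) powr \<theta> - orthant_volume (n - 1) / 2 * ((\<Sum>i=1..n. 1 / a i) - real n) * t ^ (n - 1)"
proof -
  have \<theta>: "real n - 2 \<le> \<theta>" using admissible_exponent_ge[OF n adm] .
  have "compact {1/M..M}" "{1/M..M} \<subseteq> {0<..}" using M by (auto intro: less_le_trans[of 0 "1/M"])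
  then obtain C T where CT: "\<And>a t. (\<forall>i\<in>{1..n}. a i \<in> {1/M..M}) \<Longrightarrow> T \<le> t \<Longrightarrow>
      \<bar>real (ellipsoid_count n a t) - unit_ball_vol (real n) * t ^ n * (\<Prod>i=1..n. a i)\<bar> \<le> C * t powr \<theta>"
    using adm unfolding admissible_exponent_def by meson
  define \<omega> V where "\<omega> = unit_ball_vol (real n)" and "V = orthant_volume (n - 1)"
  have count: "lattice_count UNIV {1..n} a (t\<^sup>2) = real (ellipsoid_count n a t)" for a t
    by (simp add: lattice_count_def lattice_points_def ellipsoid_count_def)
  have "\<forall>i\<in>{1..n}. \<exists>B\<ge>0. \<forall>a s. (\<forall>j\<in>{1..n} - {i}. 0 < a j \<and> a j \<le> M) \<and> 0 \<le> s \<longrightarrow>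
      V * (\<Prod>j\<in>{1..n} - {i}. a j) * sqrt s ^ (n - 1) - B * real (n - 1) * (1 + sqrt s) ^ (n - 2)
        \<le> positive_count ({1..n} - {i}) a s"
  proof
    fix i assume "i \<in> {1..n}"
    then have "card ({1..n} - {i}) = n - 1" by simp
    moreover have "n - 1 - 1 = n - 2" by simp
    ultimately show "\<exists>B\<ge>0. \<forall>a s. (\<forall>j\<in>{1..n} - {i}. 0 < a j \<and> a j \<le> M) \<and> 0 \<le> s \<longrightarrow>
      V * (\<Prod>j\<in>{1..n} - {i}. a j) * sqrt s ^ (n - 1) - B * real (n - 1) * (1 + sqrt s) ^ (n - 2)
        \<le> positive_count ({1..n} - {i}) a s"
      using positive_count_ge[of "{1..n} - {i}" M] M unfolding V_def by simp
  qed
  then obtain B where B: "\<And>i a s. i \<in> {1..n} \<Longrightarrow> (\<forall>j\<in>{1..n} - {i}. 0 < a j \<and> a j \<le> M) \<Longrightarrow> 0 \<le> s \<Longrightarrow>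
      V * (\<Prod>j\<in>{1..n} - {i}. a j) * sqrt s ^ (n - 1) - B i * real (n - 1) * (1 + sqrt s) ^ (n - 2)
        \<le> positive_count ({1..n} - {i}) a s" and B0: "\<And>i. i \<in> {1..n} \<Longrightarrow> 0 \<le> B i"
    by (metis (no_types, lifting))
  define R where "R = {J. J \<subseteq> {1..n} \<and> card J + 2 \<le> n}"
  define p where "p = (2::real) ^ (n - 1)"
  have p: "2 ^ n = 2 * p" using n by (cases n) (auto simp: p_def)
  have p0: "0 < p" by (simp add: p_def)
  \<comment> \<open>\<open>D1\<close> bounds the facet errors of the cuboid, \<open>D2\<close> the
    faces of codimension at least 2 of the cube; \<open>C\<close> enters twice, once for each full
    count.\<close>
  define D1 where "D1 = p * (\<Sum>i=1..n. B i * real (n - 1))"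
  define D2 where "D2 = (\<Sum>J\<in>R. 2 ^ card J * orthant_volume (card J))"
  define D where "D = (2 * \<bar>C\<bar> + D1 + D2) / (2 * p)"
  have "positive_count {1..n} a (t\<^sup>2) - positive_count {1..n} (\<lambda>_. 1) (t\<^sup>2)
      \<le> D * (1 + t) powr \<theta> - V / 2 * ((\<Sum>i=1..n. 1 / a i) - real n) * t ^ (n - 1)"
    if a: "unit_cuboid n a" and aM: "\<forall>i\<in>{1..n}. 1 / M \<le> a i \<and> a i \<le> M" and t: "max T 1 \<le> t" for a t
  proof -
    have t1: "1 \<le> t" "T \<le> t" using t by auto
    have a0: "\<forall>i\<in>{1..n}. 0 < a i" using a by (simp add: unit_cuboid_def)
    define P where "P = (1 + t) powr \<theta>"
    have "(1 + t) ^ (n - 2) = (1 + t) powr (real n - 2)"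
      using n t1 by (subst powr_realpow[symmetric]) (auto simp: of_nat_diff)
    also have "\<dots> \<le> P" unfolding P_def using \<theta> t1 by (intro powr_mono) auto
    finally have pow_le: "(1 + t) ^ (n - 2) \<le> P" .
    have "t powr \<theta> \<le> P" unfolding P_def using \<theta> n t1 by (intro powr_mono2) auto
    then have tP: "C * t powr \<theta> \<le> \<bar>C\<bar> * P"
      by (smt (verit) mult_left_mono mult_right_mono powr_ge_zero abs_ge_self)
    have "\<bar>lattice_count UNIV {1..n} a (t\<^sup>2) - \<omega> * t ^ n\<bar> \<le> C * t powr \<theta>"
      using CT[of a t] a aM t1 unfolding count by (simp add: unit_cuboid_def \<omega>_def)
    then have Ea: "lattice_count UNIV {1..n} a (t\<^sup>2) \<le> \<omega> * t ^ n + \<bar>C\<bar> * P" using tP by linarith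
    have "\<bar>lattice_count UNIV {1..n} (\<lambda>_. 1) (t\<^sup>2) - \<omega> * t ^ n\<bar> \<le> C * t powr \<theta>"
      using CT[of "\<lambda>_. 1" t] M t1 unfolding count by (simp add: \<omega>_def)
    then have E1: "\<omega> * t ^ n - \<bar>C\<bar> * P \<le> lattice_count UNIV {1..n} (\<lambda>_. 1) (t\<^sup>2)" using tP by linarith
    have facets_a: "V * t ^ (n - 1) * p * (\<Sum>i=1..n. 1 / a i) - D1 * P
        \<le> (\<Sum>i=1..n. p * positive_count ({1..n} - {i}) a (t\<^sup>2))"
    proof -
      have "p * (V * (1 / a i) * t ^ (n - 1) - B i * real (n - 1) * P)
          \<le> p * positive_count ({1..n} - {i}) a (t\<^sup>2)" if i: "i \<in> {1..n}" for i
      proof -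
        have "V * (\<Prod>j\<in>{1..n} - {i}. a j) * sqrt (t\<^sup>2) ^ (n - 1) - B i * real (n - 1) * (1 + sqrt (t\<^sup>2)) ^ (n - 2)
            \<le> positive_count ({1..n} - {i}) a (t\<^sup>2)"
          by (rule B) (use i a0 aM in auto)
        moreover have "B i * real (n - 1) * (1 + t) ^ (n - 2) \<le> B i * real (n - 1) * P"
          using pow_le B0[OF i] by (intro mult_left_mono) auto
        ultimately show ?thesis
          using t1 p0 unfolding unit_cuboid_prod_remove[OF a i] by (intro mult_left_mono) auto
      qed
      then have "(\<Sum>i=1..n. p * (V * (1 / a i) * t ^ (n - 1) - B i * real (n - 1) * P))
          \<le> (\<Sum>i=1..n. p * positive_count ({1..n} - {i}) a (t\<^sup>2))"
        by (rule sum_mono)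
      also have "(\<Sum>i=1..n. p * (V * (1 / a i) * t ^ (n - 1) - B i * real (n - 1) * P))
          = V * t ^ (n - 1) * p * (\<Sum>i=1..n. 1 / a i) - D1 * P"
        unfolding D1_def sum_distrib_left sum_distrib_right sum_subtractf[symmetric]
        by (intro sum.cong refl) (simp add: algebra_simps)
      finally show ?thesis .
    qed
    have facets_1: "(\<Sum>i=1..n. p * positive_count ({1..n} - {i}) (\<lambda>_. 1) (t\<^sup>2)) \<le> V * t ^ (n - 1) * p * real n"
    proof -
      have "(\<Sum>i=1..n. p * positive_count ({1..n} - {i}) (\<lambda>_. 1) (t\<^sup>2)) \<le> (\<Sum>i=1..n. p * (V * t ^ (n - 1)))"
      proof (intro sum_mono mult_left_mono)
        fix i assume "i \<in> {1..n}"
        then show "positive_count ({1..n} - {i}) (\<lambda>_. 1) (t\<^sup>2) \<le> V * t ^ (n - 1)"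
          using positive_count_le[of "{1..n} - {i}" "\<lambda>_. 1" "t\<^sup>2"] t1 by (simp add: V_def)
      qed (use p0 in auto)
      then show ?thesis by (simp add: mult_ac)
    qed
    have rest_a: "0 \<le> (\<Sum>J\<in>R. 2 ^ card J * positive_count J a (t\<^sup>2))"
      by (intro sum_nonneg mult_nonneg_nonneg lattice_count_nonneg) auto
    have rest_1: "(\<Sum>J\<in>R. 2 ^ card J * positive_count J (\<lambda>_. 1) (t\<^sup>2)) \<le> D2 * P"
      unfolding D2_def sum_distrib_right
    proof (rule sum_mono)
      fix J assume J: "J \<in> R"
      then have "finite J" using finite_subset by (auto simp: R_def)
      then have "positive_count J (\<lambda>_. 1) (t\<^sup>2) \<le> orthant_volume (card J) * t ^ card J"
        using positive_count_le[of J "\<lambda>_. 1" "t\<^sup>2"] t1 by simp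
      also have "t ^ card J \<le> (1 + t) ^ card J" using t1 by (intro power_mono) auto
      also have "\<dots> \<le> (1 + t) ^ (n - 2)" using t1 J by (intro power_increasing) (auto simp: R_def)
      also have "\<dots> \<le> P" by (rule pow_le)
      finally show "2 ^ card J * positive_count J (\<lambda>_. 1) (t\<^sup>2) \<le> 2 ^ card J * orthant_volume (card J) * P"
        by (simp add: orthant_volume_pos less_imp_le)
    qed
    have split: "lattice_count UNIV {1..n} b (t\<^sup>2) = 2 * p * positive_count {1..n} b (t\<^sup>2)
        + (\<Sum>i=1..n. p * positive_count ({1..n} - {i}) b (t\<^sup>2))
        + (\<Sum>J\<in>R. 2 ^ card J * positive_count J b (t\<^sup>2))" if "\<forall>i\<in>{1..n}. 0 < b i" for b
      using full_count_split[OF finite_atLeastAtMost that, of "t\<^sup>2"]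
      by (simp only: card_atLeastAtMost diff_Suc_1 R_def p p_def[symmetric])
    have "2 * p * positive_count {1..n} a (t\<^sup>2)
        \<le> \<omega> * t ^ n + \<bar>C\<bar> * P - V * t ^ (n - 1) * p * (\<Sum>i=1..n. 1 / a i) + D1 * P"
      using split[OF a0] Ea facets_a rest_a by linarith
    moreover have "\<omega> * t ^ n - \<bar>C\<bar> * P - V * t ^ (n - 1) * p * real n - D2 * P
        \<le> 2 * p * positive_count {1..n} (\<lambda>_. 1) (t\<^sup>2)"
      using split[of "\<lambda>_. 1"] E1 facets_1 rest_1 by simp
    ultimately have "2 * p * (positive_count {1..n} a (t\<^sup>2) - positive_count {1..n} (\<lambda>_. 1) (t\<^sup>2))
        \<le> (2 * \<bar>C\<bar> + D1 + D2) * P - V * t ^ (n - 1) * p * ((\<Sum>i=1..n. 1 / a i) - real n)"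
      by (simp add: algebra_simps)
    also have "\<dots> = 2 * p * (D * P - V / 2 * ((\<Sum>i=1..n. 1 / a i) - real n) * t ^ (n - 1))"
    proof -
      have "2 * \<bar>C\<bar> + D1 + D2 = 2 * p * D" using p0 by (simp add: D_def)
      then show ?thesis by (simp add: algebra_simps)
    qed
    finally show ?thesis using p0 by (simp add: P_def)
  qed
  then show ?thesis unfolding V_def by blast
qed

section \<open>Compactness of the sides of maximisers\<close>

lemma maximising_cuboid_cube:
  assumes "maximising_cuboid n \<gamma> \<mu> a"
  shows "unit_cuboid n a" "riesz_mean n \<gamma> \<mu> (\<lambda>_. 1) \<le> riesz_mean n \<gamma> \<mu> a"
  using assms unit_cuboid_cube[of n] by (auto simp: maximising_cuboid_def is_arg_max_def not_less)

text \<open>The lowest eigenvalue lies strictly below \<mu>; for \<gamma> > 0 an eigenvalue equal to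
  \<mu> would contribute 0.\<close>

lemma riesz_mean_cube_pos:
  assumes "real n * pi\<^sup>2 < \<mu>"
  shows "0 < riesz_mean n \<gamma> \<mu> (\<lambda>_. 1)"
proof -
  let ?k = "\<lambda>i\<in>{1..n}. 1::nat"
  have k: "?k \<in> dirichlet_indices n" "dirichlet_eigenvalue n (\<lambda>_. 1) ?k = real n * pi\<^sup>2"
    by (auto simp: dirichlet_indices_def dirichlet_eigenvalue_def)
  then show ?thesis
    unfolding riesz_mean_def
    by (intro sum_pos2[where i = ?k] finite_dirichlet_indices_le unit_cuboid_cube) (use assms in auto)
qed

text \<open>Some eigenvalue is at most \<mu>, and its i-th term alone is at least (\<pi> / a i)^2.
  For maximisers this keeps the shortest side long enough for
  \<open>positive_count_insert_le\<close>.\<close>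

lemma riesz_mean_pos_imp:
  assumes a: "unit_cuboid n a" and pos: "0 < riesz_mean n \<gamma> \<mu> a" and i: "i \<in> {1..n}"
  shows "1 \<le> a i * (sqrt \<mu> / pi)"
proof -
  obtain k where k: "k \<in> dirichlet_indices n" "dirichlet_eigenvalue n a k \<le> \<mu>"
    using pos unfolding riesz_mean_def by (metis (no_types, lifting) empty_Collect_eq less_irrefl sum.empty)
  have ai: "0 < a i" using a i by (simp add: unit_cuboid_def)
  have "1 \<le> real (k i)" using k(1) i by (auto simp: dirichlet_indices_def PiE_iff)
  then have "1 \<le> (real (k i))\<^sup>2" by simp
  then have "pi\<^sup>2 * 1 / (a i)\<^sup>2 \<le> pi\<^sup>2 * (real (k i))\<^sup>2 / (a i)\<^sup>2"
    by (intro divide_right_mono mult_left_mono) auto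
  also have "\<dots> \<le> dirichlet_eigenvalue n a k"
    unfolding dirichlet_eigenvalue_def by (rule member_le_sum[OF i]) auto
  finally have "(pi / a i)\<^sup>2 \<le> \<mu>" using k(2) by (simp add: power_divide)
  then have "pi / a i \<le> sqrt \<mu>" by (rule real_le_rsqrt)
  then show ?thesis using ai by (simp add: field_simps)
qed

lemma unit_cuboid_last_ge_1:
  assumes a: "unit_cuboid n a" and n: "1 \<le> n"
  shows "1 \<le> a n"
proof (rule ccontr)
  assume "\<not> 1 \<le> a n"
  have le: "a i \<le> a n" if "i \<in> {1..n}" for i
    using a that n by (auto simp: unit_cuboid_def mono_on_def)
  have "(\<Prod>i=1..n. a i) < (\<Prod>i=1..n. 1)"
  proof (rule prod_mono_strict[of n])
    fix i assume "i \<in> {1..n}"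
    with le[of i] a \<open>\<not> 1 \<le> a n\<close> show "0 \<le> a i \<and> a i \<le> 1"
      by (auto simp: unit_cuboid_def less_imp_le)
  qed (use n \<open>\<not> 1 \<le> a n\<close> in auto)
  then show False using a by (simp add: unit_cuboid_def)
qed

text \<open>As the product is 1, the longest side is the reciprocal of the product of the other n -
  1 sides, each at least 1 / b.\<close>

lemma unit_cuboid_bounds:
  assumes a: "unit_cuboid n a" and n: "2 \<le> n" and b: "1 \<le> b" "1 / b \<le> a 1" and i: "i \<in> {1..n}"
  shows "1 / b ^ (n - 1) \<le> a i \<and> a i \<le> b ^ (n - 1)"
proof -
  have mono: "a j \<le> a k" if "j \<in> {1..n}" "k \<in> {1..n}" "j \<le> k" for j k
    using a that by (auto simp: unit_cuboid_def mono_on_def)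
  have low: "1 / b \<le> a j" if "j \<in> {1..n}" for j
    using mono[of 1 j] b that by auto
  have "b ^ 1 \<le> b ^ (n - 1)" using n b by (intro power_increasing) auto
  then have "1 / b ^ (n - 1) \<le> 1 / b" using b by (intro divide_left_mono) auto
  then have lower: "1 / b ^ (n - 1) \<le> a i" using low[OF i] by linarith
  have "(1 / b) ^ (n - 1) = (\<Prod>j\<in>{1..n} - {n}. 1 / b)" using n by simp
  also have "\<dots> \<le> (\<Prod>j\<in>{1..n} - {n}. a j)" by (rule prod_mono) (use low b in auto)
  also have "\<dots> = 1 / a n" by (rule unit_cuboid_prod_remove[OF a]) (use n in auto)
  finally have "a n \<le> b ^ (n - 1)"
    using unit_cuboid_last_ge_1[OF a] n b by (simp add: power_divide field_simps)
  moreover have "a i \<le> a n" using mono i by auto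
  ultimately show ?thesis using lower by linarith
qed

text \<open>For t \<ge> 3/4 \<tau> the count of a maximiser falls short of the volume term by at
  least \<open>E\<close>, that of the cube by at most \<open>D\<close>. Maximality gives
  \<open>E \<le> (16/7) powr \<gamma> * D\<close>; the powers of \<tau> cancel, and 1 / a 1 is
  bounded.\<close>

lemma maximising_cuboid_bounded:
  assumes n: "2 \<le> n" and \<gamma>: "0 \<le> \<gamma>"
  shows "\<exists>M\<ge>1. \<exists>\<mu>0. \<forall>\<mu>\<ge>\<mu>0. \<forall>a. maximising_cuboid n \<gamma> \<mu> a \<longrightarrow> (\<forall>i\<in>{1..n}. 1 / M \<le> a i \<and> a i \<le> M)"
proof -
  obtain C where C: "0 \<le> C" and lower: "\<And>a s. (\<forall>i\<in>{1..n}. 0 < a i \<and> a i \<le> (1::real)) \<Longrightarrow> 0 \<le> s \<Longrightarrow>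
    orthant_volume n * (\<Prod>i=1..n. a i) * sqrt s ^ n - C * real n * (1 + sqrt s) ^ (n - 1)
      \<le> positive_count {1..n} a s"
    using positive_count_ge[of "{1..n}" "1::real"] by auto
  define c where "c = orthant_volume (n - 1) * (1/2) ^ (n - 1) / 81"
  have c: "0 < c" by (simp add: c_def orthant_volume_pos)
  \<comment> \<open>The factor 8/3 comes from 1 + \<tau> \<le> 2 \<tau> = 8/3 (3/4 \<tau>).\<close>
  define b where "b = (16/7) powr \<gamma> * (C * real n) * (8/3) ^ (n - 1) / c"
  define M where "M = max 1 b ^ (n - 1)"
  have "1 / M \<le> a i \<and> a i \<le> M"
    \<comment> \<open>The first threshold ensures \<tau> \<ge> 1, the second puts the lowest
      eigenvalue of the cube strictly below \<mu>.\<close>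
    if \<mu>: "max (pi\<^sup>2) (real n * pi\<^sup>2 + 1) \<le> \<mu>" and max: "maximising_cuboid n \<gamma> \<mu> a" and i: "i \<in> {1..n}" for \<mu> a i
  proof -
    note a = maximising_cuboid_cube(1)[OF max]
    have a1: "0 < a 1" and a0: "\<forall>i\<in>{1..n}. 0 < a i" using a n by (auto simp: unit_cuboid_def)
    define \<tau> where "\<tau> = sqrt \<mu> / pi"
    have "sqrt (pi\<^sup>2) \<le> sqrt \<mu>" using \<mu> by (subst real_sqrt_le_iff) auto
    then have \<tau>: "1 \<le> \<tau>" by (simp add: \<tau>_def)
    have "0 < riesz_mean n \<gamma> \<mu> a"
      using riesz_mean_cube_pos[of n \<mu> \<gamma>] \<mu> maximising_cuboid_cube(2)[OF max] by linarith
    then have a\<tau>: "1 \<le> a 1 * \<tau>"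
      unfolding \<tau>_def by (rule riesz_mean_pos_imp[OF a]) (use n in auto)
    define D E where "D = C * real n * (1 + \<tau>) ^ (n - 1)" and "E = c / a 1 * (3/4 * \<tau>) ^ (n - 1)"
    have "E \<le> (16/7) powr \<gamma> * D"
    proof (rule riesz_mean_comparison[OF a unit_cuboid_cube \<gamma> _ maximising_cuboid_cube(2)[OF max]])
      show "0 < \<mu>" using \<mu> by (auto intro: less_le_trans[of 0 "pi\<^sup>2"])
      fix t assume t: "0 \<le> t" "t \<le> sqrt \<mu> / pi"
      have "C * real n * (1 + t) ^ (n - 1) \<le> D"
        unfolding D_def using t C by (intro mult_left_mono power_mono) (auto simp: \<tau>_def)
      then have cube: "orthant_volume n * t ^ n - D \<le> positive_count {1..n} (\<lambda>_. 1) (t\<^sup>2)"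
        using lower[of "\<lambda>_. 1" "t\<^sup>2"] t by simp
      show "positive_count {1..n} a (t\<^sup>2) - positive_count {1..n} (\<lambda>_. 1) (t\<^sup>2)
          \<le> D - (if 3/4 * (sqrt \<mu> / pi) \<le> t then E else 0)"
      proof (cases "3/4 * \<tau> \<le> t")
        case True
        have ins: "insert 1 ({1..n} - {1}) = {1..n}" using n by auto
        have cardI: "card ({1..n} - {1}) = n - 1" "n - 1 + 1 = n" using n by auto
        have prods: "prod a {1..n} = 1" "prod a ({1..n} - {1}) = 1 / a 1"
          using a n unit_cuboid_prod_remove[OF a, of 1] by (auto simp: unit_cuboid_def)
        have "a 1 * (3/4 * \<tau>) \<le> a 1 * t" using True a1 by (intro mult_left_mono) auto
        then have at: "3/4 \<le> a 1 * t" using a\<tau> by simp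
        have t0: "0 < t" using True \<tau> by auto
        have "2 \<in> {1..n} - {1}" using n by auto
        then have "{1..n} - {1} \<noteq> {}" by blast
        then have "positive_count {1..n} a (t\<^sup>2) \<le> orthant_volume n * t ^ n - c / a 1 * t ^ (n - 1)"
          using positive_count_insert_le[of "{1..n} - {1}" 1 a "t\<^sup>2"] a0 at t0
          unfolding ins cardI prods by (simp add: c_def)
        moreover have "E \<le> c / a 1 * t ^ (n - 1)"
          unfolding E_def using True c a1 \<tau> by (intro mult_left_mono power_mono) auto
        ultimately show ?thesis using cube True by (simp add: \<tau>_def)
      next
        case False
        have "positive_count {1..n} a (t\<^sup>2) \<le> orthant_volume n * t ^ n"
          using positive_count_le[of "{1..n}" a "t\<^sup>2"] a a0 t by (simp add: unit_cuboid_def)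
        then show ?thesis using cube False by (simp add: \<tau>_def)
      qed
    qed
    also have "D \<le> C * real n * (2 * \<tau>) ^ (n - 1)"
      unfolding D_def using \<tau> C by (intro mult_left_mono power_mono) auto
    finally have "E \<le> (16/7) powr \<gamma> * (C * real n * (2 * \<tau>) ^ (n - 1))" by simp
    also have "2 * \<tau> = 8/3 * (3/4 * \<tau>)" by simp
    finally have "c / a 1 * (3/4 * \<tau>) ^ (n - 1)
        \<le> (16/7) powr \<gamma> * (C * real n) * (8/3) ^ (n - 1) * (3/4 * \<tau>) ^ (n - 1)"
      unfolding E_def power_mult_distrib by (simp only: mult_ac)
    then have "c / a 1 \<le> (16/7) powr \<gamma> * (C * real n) * (8/3) ^ (n - 1)"
      by (rule mult_right_le_imp_le) (use \<tau> in auto)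
    then have "1 / a 1 \<le> max 1 b" using c unfolding b_def by (simp add: field_simps le_max_iff_disj)
    then have "1 / max 1 b \<le> a 1" using a1 by (simp add: field_simps)
    then show ?thesis
      unfolding M_def by (intro unit_cuboid_bounds[OF a n _ _ i]) auto
  qed
  moreover have "1 \<le> M" by (simp add: M_def one_le_power)
  ultimately show ?thesis by blast
qed

text \<open>The weights \<open>1 / a i\<close> have product 1, so \<open>x - 1 - ln x\<close> may be summed instead of \<open>x - 1\<close>.\<close>

lemma sum_inverse_unit_cuboid_ge:
  assumes a: "unit_cuboid n a" and n: "1 \<le> n" and M: "a n \<le> M"
  shows "(a n - 1)\<^sup>2 / (2 * M\<^sup>2) \<le> (\<Sum>i=1..n. 1 / a i) - real n"
proof -
  have a0: "0 < a i" if "i \<in> {1..n}" for i using a that by (simp add: unit_cuboid_def)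
  have an: "1 \<le> a n" using unit_cuboid_last_ge_1[OF a n] .
  define x where "x = 1 / a n"
  have x: "0 < x" "x \<le> 1" using an by (auto simp: x_def)
  \<comment> \<open>The second-order term is the source of the square: the difference of the two
    sides vanishes at 1 and has derivative -(1 - y)^2 / y.\<close>
  have ln_le: "ln x \<le> x - 1 - (1 - x)\<^sup>2 / 2"
  proof -
    have "(\<lambda>y. y - 1 - (1 - y)\<^sup>2 / 2 - ln y) 1 \<le> (\<lambda>y. y - 1 - (1 - y)\<^sup>2 / 2 - ln y) x"
    proof (rule DERIV_nonpos_imp_nonincreasing[OF x(2)])
      fix y assume "x \<le> y" "y \<le> 1"
      then have y: "0 < y" "y \<le> 1" using x by auto
      have "((\<lambda>y. y - 1 - (1 - y)\<^sup>2 / 2 - ln y) has_real_derivative (1 + (1 - y) - 1 / y)) (at y)"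
        using y by (auto intro!: derivative_eq_intros simp: field_simps)
      moreover have "1 + (1 - y) - 1 / y = - ((1 - y)\<^sup>2 / y)"
        using y by (simp add: field_simps power2_eq_square)
      then have "1 + (1 - y) - 1 / y \<le> 0" using y by simp
      ultimately show "\<exists>z. ((\<lambda>y. y - 1 - (1 - y)\<^sup>2 / 2 - ln y) has_real_derivative z) (at y) \<and> z \<le> 0"
        by blast
    qed
    then show ?thesis by simp
  qed
  have "(\<Sum>i=1..n. ln (a i)) = ln (\<Prod>i=1..n. a i)"
    by (rule ln_prod[symmetric]) (use a0 less_irrefl in \<open>auto, metis\<close>)
  then have ln0: "(\<Sum>i=1..n. ln (a i)) = 0" using a by (simp add: unit_cuboid_def)
  have "(a n - 1) / M \<le> (a n - 1) / a n" using an M by (intro divide_left_mono) auto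
  also have "\<dots> = 1 - x" using an by (simp add: x_def field_simps)
  finally have "((a n - 1) / M)\<^sup>2 \<le> (1 - x)\<^sup>2" using an M by (intro power_mono) auto
  then have "(a n - 1)\<^sup>2 / (2 * M\<^sup>2) \<le> (1 - x)\<^sup>2 / 2" by (simp add: power_divide)
  also have "\<dots> \<le> 1 / a n - 1 + ln (a n)" using ln_le an by (simp add: x_def ln_div)
  \<comment> \<open>All summands are nonnegative, so the one at \<open>n\<close> may stand for the
    sum.\<close>
  also have "\<dots> \<le> (\<Sum>i=1..n. 1 / a i - 1 + ln (a i))"
  proof (rule member_le_sum)
    fix i assume "i \<in> {1..n} - {n}"
    then have "0 < a i" using a0 by auto
    then show "0 \<le> 1 / a i - 1 + ln (a i)"
      using ln_le_minus_one[of "1 / a i"] by (simp add: ln_div)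
  qed (use n in auto)
  also have "\<dots> = (\<Sum>i=1..n. 1 / a i) - real n"
    using ln0 by (simp add: sum.distrib sum_subtractf)
  finally show ?thesis .
qed

theorem proposition4p1:
  fixes n :: nat and \<gamma> \<theta> :: real and a :: "real \<Rightarrow> nat \<Rightarrow> real"
  assumes "n \<ge> 2"
    and "\<gamma> \<ge> 0"
    and "admissible_exponent n \<theta>"
    and "\<And>\<mu>. \<mu> > 0 \<Longrightarrow> maximising_cuboid n \<gamma> \<mu> (a \<mu>)"
  shows "(\<lambda>\<mu>. a \<mu> n - 1) \<in> O[at_top](\<lambda>\<mu>. \<mu> powr ((\<theta> - (real n - 1)) / 4))"
proof -
  note n = assms(1) and \<gamma> = assms(2)
  have \<theta>: "0 \<le> \<theta>" using admissible_exponent_ge[OF n assms(3)] n by linarith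
  obtain M \<mu>0 where M: "1 \<le> M"
    and bounded: "\<And>\<mu> b. \<mu>0 \<le> \<mu> \<Longrightarrow> maximising_cuboid n \<gamma> \<mu> b \<Longrightarrow> \<forall>i\<in>{1..n}. 1 / M \<le> b i \<and> b i \<le> M"
    using maximising_cuboid_bounded[OF n \<gamma>] by blast
  define V where "V = orthant_volume (n - 1)"
  have V: "0 < V" by (simp add: V_def orthant_volume_pos)
  obtain D0 T0 where diff: "\<And>b t. unit_cuboid n b \<Longrightarrow> \<forall>i\<in>{1..n}. 1 / M \<le> b i \<and> b i \<le> M \<Longrightarrow> T0 \<le> t \<Longrightarrow>
    positive_count {1..n} b (t\<^sup>2) - positive_count {1..n} (\<lambda>_. 1) (t\<^sup>2)
      \<le> D0 * (1 + t) powr \<theta> - V / 2 * ((\<Sum>i=1..n. 1 / b i) - real n) * t ^ (n - 1)"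
    using positive_count_cuboid_cube_diff_le[OF n assms(3) M] unfolding V_def by blast
  define T where "T = max T0 1"
  have T: "T0 \<le> T" "1 \<le> T" by (auto simp: T_def)
  define D where "D = \<bar>D0\<bar> + orthant_volume n * T ^ n"
  have D: "0 \<le> D" using T by (auto simp: D_def orthant_volume_pos less_imp_le)
  define e where "e = \<theta> - (real n - 1)"
  define K where "K = 4 * M\<^sup>2 / V * ((16/7) powr \<gamma> * D * 2 powr \<theta> * (4/3) ^ (n - 1)) * pi powr (- e)"
  have "norm (a \<mu> n - 1) \<le> sqrt K * norm (\<mu> powr (e / 4))"
    \<comment> \<open>The last threshold gives T \<le> 3/4 \<tau>, so the expansion holds wherever
      the gain is claimed.\<close>
    if \<mu>: "max (max \<mu>0 1) ((pi * (4/3 * T))\<^sup>2) \<le> \<mu>" for \<mu>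
  proof -
    have \<mu>1: "0 < \<mu>" "\<mu>0 \<le> \<mu>" using \<mu> by auto
    define b where "b = a \<mu>"
    note max = assms(4)[OF \<mu>1(1), folded b_def]
    note b = maximising_cuboid_cube(1)[OF max] and bM = bounded[OF \<mu>1(2) max]
    have b0: "\<forall>i\<in>{1..n}. 0 < b i" using b by (simp add: unit_cuboid_def)
    define \<tau> where "\<tau> = sqrt \<mu> / pi"
    have "pi * (4/3 * T) \<le> sqrt \<mu>" using \<mu> by (intro real_le_rsqrt) auto
    then have T\<tau>: "T \<le> 3/4 * \<tau>" by (simp add: \<tau>_def field_simps)
    then have \<tau>: "1 \<le> \<tau>" using T by linarith
    define \<beta> where "\<beta> = V / 2 * ((\<Sum>i=1..n. 1 / b i) - real n)"
    have "(b n - 1)\<^sup>2 / (2 * M\<^sup>2) \<le> (\<Sum>i=1..n. 1 / b i) - real n"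
      by (rule sum_inverse_unit_cuboid_ge[OF b]) (use n bM in auto)
    then have "V / 2 * ((b n - 1)\<^sup>2 / (2 * M\<^sup>2)) \<le> \<beta>"
      unfolding \<beta>_def using V by (intro mult_left_mono) auto
    then have b\<beta>: "(b n - 1)\<^sup>2 \<le> 4 * M\<^sup>2 / V * \<beta>" using V M by (simp add: field_simps)
    have "0 \<le> V / 2 * ((b n - 1)\<^sup>2 / (2 * M\<^sup>2))" using V by simp
    with \<open>V / 2 * ((b n - 1)\<^sup>2 / (2 * M\<^sup>2)) \<le> \<beta>\<close> have \<beta>: "0 \<le> \<beta>" by linarith
    have "\<beta> * (3/4 * \<tau>) ^ (n - 1) \<le> (16/7) powr \<gamma> * (D * (1 + \<tau>) powr \<theta>)"
    proof (rule riesz_mean_comparison[OF b unit_cuboid_cube \<gamma> \<mu>1(1) maximising_cuboid_cube(2)[OF max]])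
      fix t assume t: "0 \<le> t" "t \<le> sqrt \<mu> / pi"
      show "positive_count {1..n} b (t\<^sup>2) - positive_count {1..n} (\<lambda>_. 1) (t\<^sup>2)
          \<le> D * (1 + \<tau>) powr \<theta> - (if 3/4 * (sqrt \<mu> / pi) \<le> t then \<beta> * (3/4 * \<tau>) ^ (n - 1) else 0)"
      proof (cases "T \<le> t")
        case True
        have "D0 \<le> D" using T by (auto simp: D_def orthant_volume_pos less_imp_le intro: add_increasing2)
        then have "D0 * (1 + t) powr \<theta> \<le> D * (1 + t) powr \<theta>" by (rule mult_right_mono) simp
        also have "\<dots> \<le> D * (1 + \<tau>) powr \<theta>"
          using D t \<theta> by (intro mult_left_mono powr_mono2) (auto simp: \<tau>_def)
        finally have "positive_count {1..n} b (t\<^sup>2) - positive_count {1..n} (\<lambda>_. 1) (t\<^sup>2)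
            \<le> D * (1 + \<tau>) powr \<theta> - \<beta> * t ^ (n - 1)"
          using diff[OF b bM, of t] True T by (simp add: \<beta>_def)
        moreover have "0 \<le> \<beta> * t ^ (n - 1)" using \<beta> t by simp
        moreover have "\<beta> * (3/4 * \<tau>) ^ (n - 1) \<le> \<beta> * t ^ (n - 1)" if "3/4 * \<tau> \<le> t"
          using that \<beta> \<tau> by (intro mult_left_mono power_mono) auto
        ultimately show ?thesis unfolding \<tau>_def[symmetric] by auto
      next
        case False
        have "positive_count {1..n} b (t\<^sup>2) \<le> orthant_volume n * t ^ n"
          using positive_count_le[of "{1..n}" b "t\<^sup>2"] b b0 t by (simp add: unit_cuboid_def)
        also have "\<dots> \<le> orthant_volume n * T ^ n"
          using False t by (intro mult_left_mono power_mono) (auto simp: orthant_volume_pos less_imp_le)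
        also have "\<dots> \<le> D * 1" by (simp add: D_def)
        also have "\<dots> \<le> D * (1 + \<tau>) powr \<theta>"
          using D \<tau> \<theta> by (intro mult_left_mono ge_one_powr_ge_zero) auto
        finally show ?thesis
          using False T\<tau> lattice_count_nonneg[of "{1..}" "{1..n}" "\<lambda>_. 1" "t\<^sup>2"]
          unfolding \<tau>_def[symmetric] by auto
      qed
    qed
    also have "\<dots> \<le> (16/7) powr \<gamma> * (D * (2 * \<tau>) powr \<theta>)"
      using D \<tau> \<theta> by (intro mult_left_mono powr_mono2) auto
    also have "\<dots> = (16/7) powr \<gamma> * D * 2 powr \<theta> * \<tau> powr \<theta>"
      using \<tau> by (simp add: powr_mult)
    \<comment> \<open>Splitting off \<tau>^(n-1) lets it cancel against the left-hand side; what
      remains is \<beta> = O(\<tau> powr e).\<close>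
    also have "\<tau> powr \<theta> = \<tau> powr e * \<tau> ^ (n - 1)"
      using n \<tau> by (subst powr_realpow[symmetric]) (auto simp: e_def of_nat_diff simp flip: powr_add)
    also have "\<tau> ^ (n - 1) = (4/3) ^ (n - 1) * (3/4 * \<tau>) ^ (n - 1)"
      by (simp flip: power_mult_distrib)
    finally have "\<beta> * (3/4 * \<tau>) ^ (n - 1)
        \<le> (16/7) powr \<gamma> * D * 2 powr \<theta> * (4/3) ^ (n - 1) * \<tau> powr e * (3/4 * \<tau>) ^ (n - 1)"
      by (simp only: mult_ac)
    then have "\<beta> \<le> (16/7) powr \<gamma> * D * 2 powr \<theta> * (4/3) ^ (n - 1) * \<tau> powr e"
      by (rule mult_right_le_imp_le) (use \<tau> in auto)
    then have "4 * M\<^sup>2 / V * \<beta> \<le> 4 * M\<^sup>2 / V * ((16/7) powr \<gamma> * D * 2 powr \<theta> * (4/3) ^ (n - 1) * \<tau> powr e)"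
      using V by (intro mult_left_mono) auto
    \<comment> \<open>Here \<tau> is sqrt \<mu> / \<pi>, which halves the exponent; the square root
      of the quadratic deficit halves it again, whence the 4 in the rate.\<close>
    also have "\<tau> powr e = pi powr (- e) * (\<mu> powr (e / 4))\<^sup>2"
    proof -
      have "sqrt \<mu> powr e = \<mu> powr (e / 2)" using \<mu>1 by (simp add: powr_half_sqrt[symmetric] powr_powr)
      also have "\<dots> = (\<mu> powr (e / 4))\<^sup>2" by (simp add: power2_eq_square flip: powr_add)
      finally show ?thesis
        using \<mu>1 by (simp add: \<tau>_def powr_divide powr_minus field_simps)
    qed
    finally have "(b n - 1)\<^sup>2 \<le> K * (\<mu> powr (e / 4))\<^sup>2"
      using b\<beta> by (simp add: K_def mult_ac)
    then have "sqrt ((b n - 1)\<^sup>2) \<le> sqrt (K * (\<mu> powr (e / 4))\<^sup>2)" by (rule real_sqrt_le_mono)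
    then show ?thesis by (simp add: real_sqrt_mult b_def)
  qed
  then have "eventually (\<lambda>\<mu>. norm (a \<mu> n - 1) \<le> sqrt K * norm (\<mu> powr (e / 4))) at_top"
    by (intro eventually_at_top_linorderI)
  then show ?thesis unfolding e_def by (rule bigoI)
qed

end
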